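(* Let $n\ge2$ and let $\Omega\subset\mathbb{R}^n$ be an open set with nonempty boundary $\partial\Omega$ of class $C^{1,1}$. If there is a subset $\Gamma\subset\partial\Omega$ with $\mathcal{H}^{n-1}(\Gamma)=0$ such that $\rho_*=\rho$ in $\partial\Omega\setminus\Gamma$, then $\mathcal{L}^n(\overline{\Sigma})=0$.
   Context: $\mathcal{L}^n$ is $n$-dimensional Lebesgue measure and $\mathcal{H}^{n-1}$ is $(n-1)$-dimensional Hausdorff measure. For an open set $\Omega\subset\mathbb{R}^n$ with nonempty boundary: $d(x):=\inf_{\xi\in\partial\Omega}|\xi-x|$ for $x\in\Omega$; $\pi(x):=\{\xi\in\partial\Omega \mid d(x)=|\xi-x|\}$; $\Sigma:=\{x\in\Omega\mid \pi(x)\text{ is not a singleton}\}$; $\overline{\Sigma}$ is the closure of $\Sigma$ in $\Omega$ (cut locus). $B^n_r(x)$ is the open ball of radius $r$ centered at $x$. For $\xi\in\partial\Omega$, an open ball $B^n_r(x)\subset\mathbb{R}^n$ ($r>0$) is a locally inner touching ball at $\xi$ if $\xi\in\partial B^n_r(x)$ and there is an open neighborhood $U$ of $\xi$ in $\mathbb{R}^n$ such that $B^n_r(x)\cap U\subset\Omega\cap U$. The inner radius of curvature $\rho:\partial\Omega\to[0,\infty]$ is $\rho(\xi):=\sup\{r>0\mid B^n_r(x)\text{ is a locally inner touching ball at }\xi\text{ for some }x\}$ if at least one locally inner touching ball at $\xi$ exists, and $\rho(\xi):=0$ otherwise. Its lower semicontinuous envelope is $\rho_*(\xi):=\lim_{r\downarrow0}\inf\{\rho(\eta)\mid\eta\in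 B^n_r(\xi)\cap\partial\Omega\}\in[0,\infty]$. "$\partial\Omega$ is of class $C^{1,1}$" has the usual meaning: near each boundary point, after a rigid motion, $\Omega$ coincides with the region strictly below the graph of a $C^1$ function of $n-1$ variables with Lipschitz gradient and $\partial\Omega$ coincides with that graph. *)

theory Defs
  imports "HOL-Analysis.Analysis"
begin

text \<open>
  The $m$-dimensional Hausdorff (outer) measure, normalised so that it agrees with Lebesgue
  measure on $m$-dimensional space.  Covering sets have to be bounded because \<^const>\<open>diameter\<close>
  is real-valued and meaningless on unbounded sets; the case distinction for the empty set
  only matters for $m = 0$, where $0^0 = 1$.
\<close>

definition hausdorff_size :: "nat \<Rightarrow> 'a::metric_space set \<Rightarrow> ennreal" where
  "hausdorff_size m C =
     (if C = {} then 0 else ennreal (unit_ball_vol (real m) * (diameter C / 2) ^ m))"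

definition hausdorff_pre :: "nat \<Rightarrow> real \<Rightarrow> 'a::metric_space set \<Rightarrow> ennreal" where
  "hausdorff_pre m \<delta> A =
     (INF C \<in> {C :: nat \<Rightarrow> 'a set. A \<subseteq> (\<Union>i. C i) \<and> (\<forall>i. bounded (C i) \<and> diameter (C i) \<le> \<delta>)}.
        \<Sum>i. hausdorff_size m (C i))"

definition hausdorff_measure :: "nat \<Rightarrow> 'a::metric_space set \<Rightarrow> ennreal" where
  "hausdorff_measure m A = (SUP \<delta> \<in> {0<..}. hausdorff_pre m \<delta> A)"

definition nearest_points :: "'a::metric_space set \<Rightarrow> 'a \<Rightarrow> 'a set" where
  "nearest_points \<Omega> x = {\<xi> \<in> frontier \<Omega>. infdist x (frontier \<Omega>) = dist \<xi> x}"

definition ridge :: "'a::metric_space set \<Rightarrow> 'a set" where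
  "ridge \<Omega> = {x \<in> \<Omega>. \<not> is_singleton (nearest_points \<Omega> x)}"

text \<open>The closure is taken relative to \<open>\<Omega>\<close>.\<close>

definition cut_locus :: "'a::metric_space set \<Rightarrow> 'a set" where
  "cut_locus \<Omega> = closure (ridge \<Omega>) \<inter> \<Omega>"

definition locally_inner_touching_ball :: "'a::metric_space set \<Rightarrow> 'a \<Rightarrow> 'a \<Rightarrow> real \<Rightarrow> bool" where
  "locally_inner_touching_ball \<Omega> \<xi> x r \<longleftrightarrow>
     r > 0 \<and> \<xi> \<in> frontier (ball x r) \<and>
     (\<exists>U. open U \<and> \<xi> \<in> U \<and> ball x r \<inter> U \<subseteq> \<Omega> \<inter> U)"

text \<open>The supremum is taken in \<^typ>\<open>ennreal\<close>, so it is $0$ if there is no touching ball.\<close>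

definition inner_radius :: "'a::metric_space set \<Rightarrow> 'a \<Rightarrow> ennreal" where
  "inner_radius \<Omega> \<xi> = (SUP r \<in> {r. \<exists>x. locally_inner_touching_ball \<Omega> \<xi> x r}. ennreal r)"

definition inner_radius_lsc :: "'a::metric_space set \<Rightarrow> 'a \<Rightarrow> ennreal" where
  "inner_radius_lsc \<Omega> \<xi> =
     Lim (at_right (0::real)) (\<lambda>r. INF \<eta> \<in> ball \<xi> r \<inter> frontier \<Omega>. inner_radius \<Omega> \<eta>)"

text \<open>The limit above always exists, by monotonicity.\<close>

lemma inner_radius_lsc_tendsto:
  "((\<lambda>r. INF \<eta> \<in> ball \<xi> r \<inter> frontier \<Omega>. inner_radius \<Omega> \<eta>) \<longlongrightarrow> inner_radius_lsc \<Omega> \<xi>)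
     (at_right (0::real))"
  and inner_radius_lsc_eq_SUP:
  "inner_radius_lsc \<Omega> \<xi> =
     (SUP r \<in> {0<..}. INF \<eta> \<in> ball \<xi> r \<inter> frontier \<Omega>. inner_radius \<Omega> \<eta>)"
proof -
  define F where "F = (\<lambda>r::real. INF \<eta> \<in> ball \<xi> r \<inter> frontier \<Omega>. inner_radius \<Omega> \<eta>)"
  define S where "S = (SUP r \<in> {0<..}. F r)"
  have anti: "F r \<le> F s" if "s \<le> r" for r s
    unfolding F_def using that by (intro INF_superset_mono) auto
  have lim: "(F \<longlongrightarrow> S) (at_right 0)"
  proof (rule order_tendstoI)
    fix a assume "a < S"
    then obtain r where r: "r > 0" "a < F r"
      unfolding S_def less_SUP_iff by auto
    have "a < F s" if "0 < s" "s < r" for s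
      using r(2) anti[of s r] that by (meson less_imp_le order_less_le_trans)
    then show "eventually (\<lambda>s. a < F s) (at_right 0)"
      using r(1) unfolding eventually_at_right_field by blast
  next
    fix a assume a: "S < a"
    have "F s < a" if "0 < s" for s
      using SUP_upper[of s "{0<..}" F] that a unfolding S_def by (meson greaterThan_iff order_le_less_trans)
    then show "eventually (\<lambda>s. F s < a) (at_right 0)"
      unfolding eventually_at_right_field by (intro exI[of _ 1]) auto
  qed
  have eq: "inner_radius_lsc \<Omega> \<xi> = S"
    unfolding inner_radius_lsc_def F_def[symmetric]
    by (rule tendsto_Lim[OF _ lim]) simp
  show "((\<lambda>r. INF \<eta> \<in> ball \<xi> r \<inter> frontier \<Omega>. inner_radius \<Omega> \<eta>) \<longlongrightarrow> inner_radius_lsc \<Omega> \<xi>) (at_right (0::real))"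
    using lim unfolding eq F_def .
  show "inner_radius_lsc \<Omega> \<xi> = (SUP r \<in> {0<..}. INF \<eta> \<in> ball \<xi> r \<inter> frontier \<Omega>. inner_radius \<Omega> \<eta>)"
    unfolding eq S_def F_def ..
qed

text \<open>
  Functions of $n-1$ variables are functions on the coordinate hyperplane orthogonal to a basis
  vector \<open>e\<close>; their values off the hyperplane are irrelevant.  Requiring the gradient to lie
  in the hyperplane makes it unique.  The Lipschitz condition implies that it is continuous.
\<close>

definition C11_on_hyperplane :: "'a::euclidean_space \<Rightarrow> ('a \<Rightarrow> real) \<Rightarrow> bool" where
  "C11_on_hyperplane e g \<longleftrightarrow>
     (\<exists>G L. (\<forall>y. y \<bullet> e = 0 \<longrightarrow>
               G y \<bullet> e = 0 \<and> (g has_derivative (\<lambda>h. G y \<bullet> h)) (at y within {y. y \<bullet> e = 0})) \<and>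
            L-lipschitz_on {y. y \<bullet> e = 0} G)"

text \<open>
  The rigid motion is \<open>x \<mapsto> c + f x\<close>; in the new coordinates \<open>y\<close>, the height is \<open>y \<bullet> e\<close> and
  the remaining $n-1$ coordinates form the vector \<open>y - (y \<bullet> e) *\<^sub>R e\<close>.
\<close>

definition C11_boundary :: "'a::euclidean_space set \<Rightarrow> bool" where
  "C11_boundary \<Omega> \<longleftrightarrow>
     (\<forall>\<xi> \<in> frontier \<Omega>. \<exists>U (f :: 'a \<Rightarrow> 'a) c e g.
        open U \<and> \<xi> \<in> U \<and> orthogonal_transformation f \<and> e \<in> Basis \<and> C11_on_hyperplane e g \<and>
        (\<forall>x \<in> U. let y = c + f x in
           (x \<in> \<Omega> \<longleftrightarrow> y \<bullet> e < g (y - (y \<bullet> e) *\<^sub>R e)) \<and>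
           (x \<in> frontier \<Omega> \<longleftrightarrow> y \<bullet> e = g (y - (y \<bullet> e) *\<^sub>R e))))"

end

theory Submission imports Defs begin

text \<open>
  For a closed set \<open>S\<close>, call \<open>x\<close> a ray end if no segment from a nearest point through \<open>x\<close> stays
  minimal beyond \<open>x\<close>.  Ray ends form a null set: moving the ray ends in a compact set \<open>K\<close> towards
  their nearest points by different fractions \<open>s\<close> gives pairwise disjoint bounded compact sets, and
  by monotonicity of the nearest point map each of them has measure at least a fixed fraction of
  that of \<open>K\<close>.

  All points of \<open>ridge \<Omega>\<close> are ray ends.  Let \<open>x\<close> be a limit of points \<open>q\<close> of \<open>ridge \<Omega>\<close> with a
  unique nearest point \<open>\<xi>\<close>.  On a boundary curve joining two nearest points of \<open>q\<close>, the distance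
  to \<open>q\<close> has an interior maximum, where the inner radius is hardly larger than the distance from
  \<open>x\<close> to \<open>\<xi>\<close>.  If the inner radius agrees with its envelope at \<open>\<xi>\<close>, its value there is therefore
  the distance from \<open>x\<close>, and \<open>x\<close> is a ray end.  Otherwise \<open>\<xi>\<close> lies in the exceptional set, and \<open>x\<close> on
  the normal line at \<open>\<xi>\<close>; as the normals are Lipschitz, these lines sweep out a null set.
\<close>


section \<open>Lebesgue measure under maps with Lipschitz inverse\<close>

lemma dist_le_cube:
  fixes x y u v :: "'a::euclidean_space"
  assumes "x \<in> cbox u v" "y \<in> cbox u v" "\<And>i. i \<in> Basis \<Longrightarrow> v \<bullet> i - u \<bullet> i = w"
  shows "dist x y \<le> real DIM('a) * w"
proof -
  have "norm (x - y) \<le> (\<Sum>i\<in>Basis. \<bar>(x - y) \<bullet> i\<bar>)"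
    by (rule norm_le_l1)
  also have "\<dots> \<le> real DIM('a) * w"
  proof (rule sum_bounded_above)
    fix i :: 'a assume i: "i \<in> Basis"
    then show "\<bar>(x - y) \<bullet> i\<bar> \<le> w"
      using assms(1,2) assms(3)[OF i] by (auto simp: mem_box inner_diff_left dest!: bspec[OF _ i])
  qed
  finally show ?thesis by (simp add: dist_norm)
qed

text \<open>Cover \<open>T\<close> by cubes of total volume close to that of \<open>T\<close>. With
  \<open>n = DIM('a)\<close>, points of \<open>S\<close> sent into a cube of side \<open>w\<close>
  are at mutual distance at most \<open>L * n * w\<close>, so one ball of that radius holds them
  all, and its volume is a fixed multiple of that of the cube.\<close>

lemma measure_le_of_expanding:
  fixes h :: "'a::euclidean_space \<Rightarrow> 'a"
  assumes S: "S \<in> lmeasurable" and T: "T \<in> lmeasurable" "bounded T" and hS: "h ` S \<subseteq> T"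
    and L: "L \<ge> 0" "\<And>x y. x \<in> S \<Longrightarrow> y \<in> S \<Longrightarrow> dist x y \<le> L * dist (h x) (h y)"
  shows "measure lebesgue S
           \<le> unit_ball_vol (real DIM('a)) * (L * real DIM('a)) ^ DIM('a) * measure lebesgue T"
proof -
  define n where "n = DIM('a)"
  define C where "C = unit_ball_vol (real n) * (L * real n) ^ n"
  have n: "n > 0" by (simp add: n_def)
  have C: "C \<ge> 0" using L by (simp add: C_def unit_ball_vol_nonneg)
  obtain B where B: "B > 0" "\<And>x. x \<in> T \<Longrightarrow> norm x \<le> B"
    using T(2) bounded_pos by metis
  \<comment> \<open>The bounding box is a cube, so that its dyadic pieces are cubes as well.\<close>
  define b :: 'a where "b = B *\<^sub>R One"
  have Tb: "T \<subseteq> cbox (-b) b"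
  proof
    fix x assume x: "x \<in> T"
    have "\<bar>x \<bullet> i\<bar> \<le> B" if "i \<in> Basis" for i
      using Basis_le_norm[OF that, of x] B(2)[OF x] by linarith
    then show "x \<in> cbox (-b) b"
      by (force simp: mem_box b_def abs_le_iff)
  qed
  have "measure lebesgue S \<le> C * (measure lebesgue T + e)" if e: "e > 0" for e
  proof -
    obtain D where D: "countable D"
      "\<And>K. K \<in> D \<Longrightarrow> K \<subseteq> cbox (-b) b \<and> K \<noteq> {} \<and> (\<exists>c d. K = cbox c d)"
      "pairwise (\<lambda>A B. interior A \<inter> interior B = {}) D"
      "\<And>u v. cbox u v \<in> D \<Longrightarrow> \<exists>n. \<forall>i \<in> Basis. v \<bullet> i - u \<bullet> i = (b \<bullet> i - (-b) \<bullet> i)/2^n"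
      "T \<subseteq> \<Union>D" "\<Union>D \<in> lmeasurable" "measure lebesgue (\<Union>D) \<le> measure lebesgue T + e"
      by (rule measurable_outer_intervals_bounded[OF T(1) Tb e]) blast
    \<comment> \<open>The side of a cube is recovered as a root of its volume. The ball
      \<open>W X\<close> is centred at some point of \<open>S\<close> sent into \<open>X\<close>; if
      there is none, the centre is a default value and the ball merely enlarges the cover.\<close>
    define w where "w X = root n (measure lebesgue X)" for X :: "'a set"
    define W where "W X = cball (SOME x. x \<in> S \<and> h x \<in> X) (L * real n * w X)" for X
    have cube: "dist x y \<le> real n * w X" if X: "X \<in> D" "x \<in> X" "y \<in> X" for X x y
    proof -
      obtain u v where uv: "X = cbox u v" using D(2)[OF X(1)] by blast
      then obtain k where "\<forall>i \<in> Basis. v \<bullet> i - u \<bullet> i = (b \<bullet> i - (-b) \<bullet> i)/2^k"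
        using D(4) X by blast
      then have k: "v \<bullet> i - u \<bullet> i = 2 * B / 2 ^ k" if "i \<in> Basis" for i
        using that by (simp add: b_def)
      have le: "u \<bullet> i \<le> v \<bullet> i" if "i \<in> Basis" for i
        using k[OF that] B(1) by (smt (verit) divide_nonneg_nonneg zero_le_power)
      have "measure lebesgue X = (2 * B / 2 ^ k) ^ n"
        using k le by (simp add: uv content_cbox n_def inner_diff_left)
      then have "w X = 2 * B / 2 ^ k"
        using B(1) n by (simp add: w_def real_root_power_cancel)
      then show ?thesis
        using dist_le_cube[of x u v y "2 * B / 2 ^ k"] k X uv by (simp add: n_def)
    qed
    have w0: "w X \<ge> 0" for X by (simp add: w_def n)
    have mW: "measure lebesgue (W X) = C * measure lebesgue X" if "X \<in> D" for X
    proof -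
      have "measure lebesgue (W X) = unit_ball_vol (real n) * (L * real n * w X) ^ n"
        unfolding W_def using L w0[of X] by (simp add: content_cball n_def)
      also have "w X ^ n = measure lebesgue X"
        using n by (simp add: w_def)
      then have "(L * real n * w X) ^ n = (L * real n) ^ n * measure lebesgue X"
        by (simp add: power_mult_distrib)
      finally show ?thesis by (simp add: C_def)
    qed
    have fin: "measure lebesgue (\<Union>X\<in>I. W X) \<le> C * (measure lebesgue T + e)"
      if I: "I \<subseteq> D" "finite I" for I
    proof -
      have div: "I division_of \<Union>I"
        using pairwise_subset [OF D(3) I(1)] I(2) D(2) I(1) unfolding pairwise_def division_of_def
        by (metis Union_upper subsetD)
      have "measure lebesgue (\<Union>X\<in>I. W X) \<le> (\<Sum>X\<in>I. measure lebesgue (W X))"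
        using I by (intro measure_UNION_le) (auto simp: W_def)
      also have "\<dots> = C * (\<Sum>X\<in>I. measure lebesgue X)"
        using I(1) mW by (simp add: sum_distrib_left subset_iff)
      also have "(\<Sum>X\<in>I. measure lebesgue X) = measure lebesgue (\<Union>I)"
        using content_division[OF div] by simp
      also have "\<dots> \<le> measure lebesgue (\<Union>D)"
        using I D(6) fmeasurableD[OF lmeasurable_division[OF div]]
        by (intro measure_mono_fmeasurable) auto
      finally show ?thesis using C D(7) by (smt (verit) mult_left_mono)
    qed
    have meas: "W X \<in> lmeasurable" for X by (simp add: W_def)
    have U: "(\<Union>X\<in>D. W X) \<in> lmeasurable"
      by (rule fmeasurable_UN_bound[OF D(1) meas fin])
    have "S \<subseteq> (\<Union>X\<in>D. W X)"
    proof
      fix x assume x: "x \<in> S"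
      then obtain X where X: "X \<in> D" "h x \<in> X" using hS D(5) by blast
      define z where "z = (SOME x. x \<in> S \<and> h x \<in> X)"
      have z: "z \<in> S \<and> h z \<in> X" unfolding z_def by (rule someI[of _ x]) (use x X in blast)
      have "dist z x \<le> L * dist (h z) (h x)" using L z x by blast
      also have "\<dots> \<le> L * (real n * w X)" using L cube X z by (intro mult_left_mono) auto
      finally show "x \<in> (\<Union>X\<in>D. W X)" using X by (auto simp: W_def z_def mult.assoc)
    qed
    then have "measure lebesgue S \<le> measure lebesgue (\<Union>X\<in>D. W X)"
      using S U by (intro measure_mono_fmeasurable) auto
    also have "\<dots> \<le> C * (measure lebesgue T + e)"
      by (rule measure_UN_bound[OF D(1) meas fin])
    finally show ?thesis .
  qed
  note * = this
  have "measure lebesgue S \<le> C * measure lebesgue T"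
  proof (rule field_le_epsilon)
    fix e :: real assume e: "e > 0"
    \<comment> \<open>\<open>C\<close> vanishes for \<open>L = 0\<close>, hence the divisor
      \<open>C + 1\<close>.\<close>
    have "measure lebesgue S \<le> C * (measure lebesgue T + e / (C + 1))"
      using * C e by simp
    also have "\<dots> = C * measure lebesgue T + C / (C + 1) * e" by (simp add: algebra_simps)
    also have "C / (C + 1) * e \<le> 1 * e" using C e by (intro mult_right_mono) auto
    finally show "measure lebesgue S \<le> C * measure lebesgue T + e" by simp
  qed
  then show ?thesis by (simp add: C_def n_def)
qed

section \<open>Nearest points and contraction along minimal segments\<close>

text \<open>\<open>nearest (frontier \<Omega>)\<close> is \<open>nearest_points \<Omega>\<close>.\<close>

definition nearest :: "'a::metric_space set \<Rightarrow> 'a \<Rightarrow> 'a set" where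
  "nearest S x = {\<xi> \<in> S. infdist x S = dist \<xi> x}"

text \<open>The extension is parametrised from the nearest point, with \<open>x\<close> at
  \<open>t = 1\<close>. Points of \<open>S\<close> itself are never ray ends, since for them the
  extension stays at \<open>x\<close>.\<close>

definition ray_ends :: "'a::real_normed_vector set \<Rightarrow> 'a set" where
  "ray_ends S = {x. \<forall>\<xi> \<in> nearest S x. \<forall>t>1. \<xi> \<notin> nearest S (\<xi> + t *\<^sub>R (x - \<xi>))}"

lemma nearestD: "\<xi> \<in> nearest S x \<Longrightarrow> \<eta> \<in> S \<Longrightarrow> dist \<xi> x \<le> dist \<eta> x"
  unfolding nearest_def using infdist_le[of \<eta> S x] by (auto simp: dist_commute)

lemma nearestI:
  assumes "\<xi> \<in> S" "\<And>\<eta>. \<eta> \<in> S \<Longrightarrow> dist \<xi> x \<le> dist \<eta> x"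
  shows "\<xi> \<in> nearest S x"
proof -
  have "dist \<xi> x \<le> (INF \<eta>\<in>S. dist x \<eta>)"
    using assms by (intro cINF_greatest) (auto simp: dist_commute)
  then have "dist \<xi> x \<le> infdist x S" using assms(1) by (auto simp: infdist_def)
  then show ?thesis
    using assms(1) infdist_le[of \<xi> S x] by (simp add: nearest_def dist_commute)
qed

lemma nearest_exists:
  fixes S :: "'a::heine_borel set"
  assumes "closed S" "S \<noteq> {}"
  shows "nearest S x \<noteq> {}"
  using infdist_attains_inf[OF assms, of x] by (auto simp: nearest_def dist_commute)

text \<open>Summing the two inequalities between squared distances cancels all squares. Behind this,
  nearest points of \<open>x\<close> are subgradients of the convex function (|x|^2 - d(x)^2) / 2,
  with d the distance to \<open>S\<close>.\<close>

lemma nearest_monotone: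
  fixes S :: "'a::real_inner set"
  assumes "\<xi> \<in> nearest S x" "\<eta> \<in> nearest S y"
  shows "(x - y) \<bullet> (\<xi> - \<eta>) \<ge> 0"
proof -
  have "\<xi> \<in> S" "\<eta> \<in> S" using assms by (auto simp: nearest_def)
  then have "(dist \<xi> x)\<^sup>2 \<le> (dist \<eta> x)\<^sup>2" "(dist \<eta> y)\<^sup>2 \<le> (dist \<xi> y)\<^sup>2"
    using nearestD assms by (auto intro!: power_mono)
  then show ?thesis
    by (simp add: dist_norm power2_norm_eq_inner algebra_simps inner_commute)
qed

text \<open>The contracted points differ by \<open>(1 - s) *\<^sub>R p + s *\<^sub>R q\<close>,
  where \<open>p \<bullet> q \<ge> 0\<close> by monotonicity; the norm of this is at least
  \<open>(1 - s) * norm p\<close>.\<close>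

lemma dist_le_dist_contract:
  fixes S :: "'a::real_inner set"
  assumes "\<xi> \<in> nearest S x" "\<eta> \<in> nearest S y" "0 \<le> s" "s < 1"
  shows "dist x y \<le> inverse (1 - s) * dist (x + s *\<^sub>R (\<xi> - x)) (y + s *\<^sub>R (\<eta> - y))"
proof -
  define p q where "p = x - y" and "q = \<xi> - \<eta>"
  have pq: "p \<bullet> q \<ge> 0" using nearest_monotone assms(1,2) by (simp add: p_def q_def)
  have eq: "(x + s *\<^sub>R (\<xi> - x)) - (y + s *\<^sub>R (\<eta> - y)) = (1 - s) *\<^sub>R p + s *\<^sub>R q"
    by (simp add: p_def q_def algebra_simps)
  have "((1 - s) * norm p)\<^sup>2 \<le> (norm ((1 - s) *\<^sub>R p + s *\<^sub>R q))\<^sup>2"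
  proof -
    have "(norm ((1 - s) *\<^sub>R p + s *\<^sub>R q))\<^sup>2
        = ((1 - s) * norm p)\<^sup>2 + 2 * ((1 - s) * s * (p \<bullet> q)) + (s * norm q)\<^sup>2"
      unfolding power_mult_distrib power2_norm_eq_inner
      by (simp add: inner_simps inner_commute[of q p] power2_eq_square algebra_simps)
    moreover have "(1 - s) * s * (p \<bullet> q) \<ge> 0" using pq assms by simp
    ultimately show ?thesis by (smt (verit) zero_le_power2)
  qed
  then have "(1 - s) * norm p \<le> norm ((1 - s) *\<^sub>R p + s *\<^sub>R q)"
    by (rule power2_le_imp_le) simp
  then have "norm p \<le> inverse (1 - s) * norm ((1 - s) *\<^sub>R p + s *\<^sub>R q)"
    using assms(4) by (simp add: field_simps)
  then show ?thesis by (simp only: dist_norm eq p_def[symmetric])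
qed

text \<open>The sphere about the contracted point through \<open>\<xi>\<close> touches the sphere
  about \<open>x\<close> through \<open>\<xi>\<close> from inside, only at \<open>\<xi>\<close>, and
  no point of \<open>S\<close> lies inside the latter.\<close>

lemma nearest_unique_inside:
  fixes S :: "'a::real_inner set"
  assumes "\<xi> \<in> nearest S x" "0 < s" "s < 1" "\<eta> \<in> nearest S (x + s *\<^sub>R (\<xi> - x))"
  shows "\<eta> = \<xi>"
proof -
  define p q where "p = \<xi> - x" and "q = \<eta> - x"
  have S: "\<xi> \<in> S" "\<eta> \<in> S" using assms by (auto simp: nearest_def)
  have 1: "(dist \<xi> x)\<^sup>2 \<le> (dist \<eta> x)\<^sup>2"
    using nearestD[OF assms(1) S(2)] by (intro power_mono) auto
  have 2: "(dist \<eta> (x + s *\<^sub>R (\<xi> - x)))\<^sup>2 \<le> (dist \<xi> (x + s *\<^sub>R (\<xi> - x)))\<^sup>2"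
    using nearestD[OF assms(4) S(1)] by (intro power_mono) auto
  have m1: "p \<bullet> p \<le> q \<bullet> q"
    using 1 by (simp add: dist_norm power2_norm_eq_inner p_def q_def)
  have m2: "(q - s *\<^sub>R p) \<bullet> (q - s *\<^sub>R p) \<le> (p - s *\<^sub>R p) \<bullet> (p - s *\<^sub>R p)"
    using 2 by (simp add: dist_norm power2_norm_eq_inner p_def q_def algebra_simps)
  have "q \<bullet> q - 2 * s * (p \<bullet> q) \<le> p \<bullet> p - 2 * s * (p \<bullet> p)"
    using m2 by (simp add: inner_diff_left inner_diff_right inner_commute)
  moreover have "(q - p) \<bullet> (q - p) = q \<bullet> q - 2 * (p \<bullet> q) + p \<bullet> p"
    by (simp add: inner_diff_left inner_diff_right inner_commute)
  ultimately have "s * ((q - p) \<bullet> (q - p)) \<le> (1 - s) * (p \<bullet> p - q \<bullet> q)"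
    by (simp add: algebra_simps)
  also have "\<dots> \<le> 0" using m1 assms(3) by (simp add: mult_nonneg_nonpos)
  finally have "(q - p) \<bullet> (q - p) \<le> 0"
    using assms(2) by (simp add: mult_le_0_iff)
  then have "(q - p) \<bullet> (q - p) = 0" using inner_ge_zero by (rule antisym)
  then have "q = p" by simp
  then show ?thesis by (simp add: p_def q_def)
qed

lemma nearest_inside:
  fixes S :: "'a::real_normed_vector set"
  assumes "\<xi> \<in> nearest S x" "0 \<le> s" "s \<le> 1"
  shows "\<xi> \<in> nearest S (x + s *\<^sub>R (\<xi> - x))"
proof (rule nearestI)
  show "\<xi> \<in> S" using assms by (simp add: nearest_def)
  fix z assume "z \<in> S"
  then have "dist \<xi> x \<le> dist z x" by (rule nearestD[OF assms(1)])
  also have "\<dots> \<le> dist z (x + s *\<^sub>R (\<xi> - x)) + dist (x + s *\<^sub>R (\<xi> - x)) x"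
    by (rule dist_triangle)
  also have "dist (x + s *\<^sub>R (\<xi> - x)) x = s * dist \<xi> x"
    using assms by (simp add: dist_norm)
  finally have "(1 - s) * dist \<xi> x \<le> dist z (x + s *\<^sub>R (\<xi> - x))" by (simp add: algebra_simps)
  moreover have "\<xi> - (x + s *\<^sub>R (\<xi> - x)) = (1 - s) *\<^sub>R (\<xi> - x)" by (simp add: algebra_simps)
  then have "dist \<xi> (x + s *\<^sub>R (\<xi> - x)) = (1 - s) * dist \<xi> x"
    using assms by (simp add: dist_norm)
  ultimately show "dist \<xi> (x + s *\<^sub>R (\<xi> - x)) \<le> dist z (x + s *\<^sub>R (\<xi> - x))" by simp
qed

text \<open>A common point would have only one nearest point, so \<open>\<xi> = \<eta>\<close> and
  \<open>x\<close>, \<open>y\<close> lie on one ray from it. Since \<open>s < t\<close>,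
  \<open>y\<close> is farther out by the factor \<open>(1 - s) / (1 - t) > 1\<close>, so
  \<open>\<xi>\<close> would stay nearest beyond \<open>x\<close>.\<close>

lemma contract_disjoint:
  fixes S :: "'a::real_inner set"
  assumes x: "x \<in> ray_ends S" "\<xi> \<in> nearest S x" and y: "\<eta> \<in> nearest S y"
    and st: "0 < s" "s < t" "t < 1"
  shows "x + s *\<^sub>R (\<xi> - x) \<noteq> y + t *\<^sub>R (\<eta> - y)"
proof
  assume eq: "x + s *\<^sub>R (\<xi> - x) = y + t *\<^sub>R (\<eta> - y)"
  define z where "z = \<eta>"
  have z: "z \<in> nearest S (y + t *\<^sub>R (\<eta> - y))"
    using nearest_inside[OF y] st by (simp add: z_def)
  have "z = \<xi>" using nearest_unique_inside[OF x(2), of s z] z eq st by simp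
  moreover have "z = \<eta>" using nearest_unique_inside[OF y, of t z] z st by simp
  ultimately have [simp]: "\<eta> = \<xi>" by simp
  have "(1 - s) *\<^sub>R (x - \<xi>) = (1 - t) *\<^sub>R (y - \<xi>)" using eq by (simp add: algebra_simps)
  then have "y - \<xi> = ((1 - s) / (1 - t)) *\<^sub>R (x - \<xi>)"
    using st by (metis (no_types, lifting) diff_gt_0_iff_gt less_irrefl divide_inverse_commute
        scaleR_scaleR scaleR_one left_inverse)
  then have "\<xi> + ((1 - s) / (1 - t)) *\<^sub>R (x - \<xi>) = y" by (simp add: algebra_simps)
  moreover have "(1 - s) / (1 - t) > 1" using st by (simp add: field_simps)
  ultimately show False using x y unfolding ray_ends_def by force
qed


section \<open>Ray ends form a null set\<close>

text \<open>Sets of points built from \<open>x\<close> and its nearest points thereby become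
  continuous images of compact sets, so their measurability does not depend on a choice of nearest
  points.\<close>

lemma compact_nearest_graph:
  fixes S :: "'a::euclidean_space set"
  assumes "closed S" "S \<noteq> {}" "compact K"
  shows "compact {z. fst z \<in> K \<and> snd z \<in> nearest S (fst z)}" (is "compact ?Q")
unfolding compact_eq_bounded_closed
proof
  have "?Q = (fst -` K \<inter> snd -` S) \<inter> {z. infdist (fst z) S = dist (snd z) (fst z)}"
    by (auto simp: nearest_def)
  moreover have "closed (fst -` K :: ('a \<times> 'a) set)" "closed (snd -` S :: ('a \<times> 'a) set)"
    using assms(1) compact_imp_closed[OF assms(3)]
    by (auto intro!: closed_vimage continuous_intros)
  moreover have "closed {z :: 'a \<times> 'a. infdist (fst z) S = dist (snd z) (fst z)}"
    by (intro closed_Collect_eq continuous_intros)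
  ultimately show "closed ?Q" by auto
  obtain B where B: "\<And>x. x \<in> K \<Longrightarrow> norm x \<le> B"
    using assms(3) compact_imp_bounded bounded_iff by metis
  have "bounded ((\<lambda>x. infdist x S) ` K)"
    using assms(3) by (intro compact_imp_bounded compact_continuous_image continuous_intros)
  then obtain D where D: "\<And>x. x \<in> K \<Longrightarrow> \<bar>infdist x S\<bar> \<le> D"
    unfolding bounded_iff by auto
  have "norm z \<le> B + (D + B)" if "z \<in> ?Q" for z
  proof -
    obtain x \<xi> where z: "z = (x, \<xi>)" by (cases z)
    then have x: "x \<in> K" and \<xi>: "infdist x S = dist \<xi> x" using that by (auto simp: nearest_def)
    have "norm \<xi> \<le> norm (\<xi> - x) + norm x" by (metis diff_add_cancel norm_triangle_ineq)
    then have "norm \<xi> \<le> D + B" using D[OF x] B[OF x] \<xi> by (simp add: dist_norm)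
    then show ?thesis using norm_Pair_le[of x \<xi>] B[OF x] z by simp
  qed
  then show "bounded ?Q" unfolding bounded_iff by blast
qed

lemma null_compact_ray_ends:
  fixes S :: "'a::euclidean_space set"
  assumes S: "closed S" "S \<noteq> {}" and K: "compact K" "K \<subseteq> ray_ends S"
  shows "measure lebesgue K = 0"
proof (rule ccontr)
  assume "measure lebesgue K \<noteq> 0"
  then have pos: "measure lebesgue K > 0" by (simp add: zero_less_measure_iff)
  define Q where "Q = {z. fst z \<in> K \<and> snd z \<in> nearest S (fst z)}"
  have Q: "compact Q" unfolding Q_def by (rule compact_nearest_graph[OF S K(1)])
  define P where "P s = (\<lambda>z. fst z + s *\<^sub>R (snd z - fst z)) ` Q" for s :: real
  have P: "compact (P s)" for s
    unfolding P_def by (intro compact_continuous_image Q continuous_intros)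
  define C where "C = unit_ball_vol (real DIM('a)) * (2 * real DIM('a)) ^ DIM('a)"
  have "C > 0" by (simp add: C_def)
  \<comment> \<open>The restriction \<open>s \<le> 1/2\<close> bounds \<open>inverse (1 - s)\<close>
    by \<open>2\<close>, making \<open>C\<close> independent of \<open>s\<close>.\<close>
  have le: "measure lebesgue K \<le> C * measure lebesgue (P s)" if s: "0 \<le> s" "s \<le> 1/2" for s
  proof -
    define p where "p x = (SOME \<xi>. \<xi> \<in> nearest S x)" for x
    have p: "p x \<in> nearest S x" for x
      unfolding p_def using nearest_exists[OF S, of x] by (simp add: some_in_eq)
    show ?thesis unfolding C_def
    proof (rule measure_le_of_expanding[where h = "\<lambda>x. x + s *\<^sub>R (p x - x)"])
      show "K \<in> lmeasurable" "P s \<in> lmeasurable" "bounded (P s)"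
        using K(1) P by (auto intro: lmeasurable_compact compact_imp_bounded)
      show "(\<lambda>x. x + s *\<^sub>R (p x - x)) ` K \<subseteq> P s"
      proof
        fix y assume "y \<in> (\<lambda>x. x + s *\<^sub>R (p x - x)) ` K"
        then obtain x where "x \<in> K" "y = x + s *\<^sub>R (p x - x)" by auto
        then show "y \<in> P s"
          unfolding P_def Q_def using p[of x] by (intro image_eqI[of _ _ "(x, p x)"]) auto
      qed
      fix x y
      have "dist x y \<le> inverse (1 - s) * dist (x + s *\<^sub>R (p x - x)) (y + s *\<^sub>R (p y - y))"
        using p s by (intro dist_le_dist_contract) auto
      also have "\<dots> \<le> 2 * dist (x + s *\<^sub>R (p x - x)) (y + s *\<^sub>R (p y - y))"
        using s by (intro mult_right_mono) (auto simp: field_simps)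
      finally show "dist x y \<le> 2 * dist (x + s *\<^sub>R (p x - x)) (y + s *\<^sub>R (p y - y))" .
    qed simp
  qed
  \<comment> \<open>Any sequence of distinct values in \<open>(0, 1/2]\<close> would serve; this one
    decreases.\<close>
  define s where "s i = 1 / (real i + 2)" for i :: nat
  have s: "0 < s i" "s i \<le> 1/2" for i by (auto simp: s_def)
  have sinj: "s j < s i" if "i < j" for i j using that by (simp add: s_def field_simps)
  have disj0: "P (s i) \<inter> P (s j) = {}" if "i < j" for i j
  proof -
    have "x + s j *\<^sub>R (\<xi> - x) \<noteq> y + s i *\<^sub>R (\<eta> - y)"
      if "x \<in> K" "\<xi> \<in> nearest S x" "\<eta> \<in> nearest S y" for x \<xi> y \<eta>
      using that K(2) s[of i] s[of j] sinj[OF \<open>i < j\<close>]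
      by (intro contract_disjoint[where S = S]) auto
    then show ?thesis unfolding P_def Q_def by fastforce
  qed
  have disj: "disjoint_family (\<lambda>i. P (s i))"
    unfolding disjoint_family_on_def using disj0 by (metis Int_commute linorder_neqE_nat)
  \<comment> \<open>Contracting by all parameters of a compact interval gives a compact set; its
    finite measure bounds the sum of the measures of the disjoint sets
    \<open>P (s i)\<close>.\<close>
  define U where "U = (\<lambda>z. fst (snd z) + fst z *\<^sub>R (snd (snd z) - fst (snd z))) ` ({0..1::real} \<times> Q)"
  have U: "compact U"
    unfolding U_def by (intro compact_continuous_image compact_Times Q continuous_intros) auto
  have PU: "P (s i) \<subseteq> U" for i
  proof
    fix y assume "y \<in> P (s i)"
    then obtain z where "z \<in> Q" "y = fst z + s i *\<^sub>R (snd z - fst z)" by (auto simp: P_def)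
    then show "y \<in> U" using s[of i] unfolding U_def by (intro image_eqI[of _ _ "(s i, z)"]) auto
  qed
  have "real m * (measure lebesgue K / C) \<le> measure lebesgue U" for m
  proof -
    have "real m * (measure lebesgue K / C) = (\<Sum>i<m. measure lebesgue K / C)" by simp
    also have "\<dots> \<le> (\<Sum>i<m. measure lebesgue (P (s i)))"
      using le s \<open>C > 0\<close> by (intro sum_mono) (simp add: field_simps less_imp_le)
    also have "\<dots> = measure lebesgue (\<Union>i<m. P (s i))"
    proof (rule measure_finite_Union[symmetric])
      show "disjoint_family_on (\<lambda>i. P (s i)) {..<m}"
        using disj by (auto simp: disjoint_family_on_def)
      show "(\<lambda>i. P (s i)) ` {..<m} \<subseteq> sets lebesgue"
        using P by (auto intro: fmeasurableD lmeasurable_compact)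
      show "emeasure lebesgue (P (s i)) \<noteq> \<infinity>" for i
        using fmeasurableD2[OF lmeasurable_compact[OF P]] by simp
    qed simp
    also have "\<dots> \<le> measure lebesgue U"
      using PU P U by (intro measure_mono_fmeasurable lmeasurable_compact)
        (auto intro!: sets.finite_UN fmeasurableD lmeasurable_compact)
    finally show ?thesis .
  qed
  moreover have "measure lebesgue K / C > 0" using pos \<open>C > 0\<close> by simp
  ultimately show False
    using reals_Archimedean3[of "measure lebesgue K / C"] by (meson not_less)
qed

text \<open>The complement is a countable union of compact sets \<open>A k m\<close>: if minimality
  persists beyond \<open>x\<close> at all, it persists up to some factor
  \<open>1 + 1 / real (Suc k)\<close>, and \<open>x\<close> lies in a ball of radius
  \<open>m\<close>.\<close>

lemma borel_ray_ends:
  fixes S :: "'a::euclidean_space set"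
  assumes S: "closed S" "S \<noteq> {}"
  shows "ray_ends S \<in> sets borel"
proof -
  define e where "e k z = snd z + (1 + 1 / real (Suc k)) *\<^sub>R (fst z - snd z)" for k and z :: "'a \<times> 'a"
  define A where "A k m = fst ` ({z. fst z \<in> cball 0 (real m) \<and> snd z \<in> nearest S (fst z)} \<inter>
      {z. infdist (e k z) S = dist (snd z) (e k z)})" for k m
  have "compact (A k m)" for k m
    unfolding A_def e_def
    by (intro compact_continuous_image compact_Int_closed compact_nearest_graph S
        closed_Collect_eq continuous_intros compact_cball)
  then have "(\<Union>k. \<Union>m. A k m) \<in> sets borel" by (intro sets.countable_UN borel_compact image_subsetI) auto
  moreover have "- ray_ends S = (\<Union>k. \<Union>m. A k m)"
  proof (intro set_eqI iffI)
    fix x assume "x \<in> - ray_ends S"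
    then obtain \<xi> t where \<xi>: "\<xi> \<in> nearest S x" "t > 1" "\<xi> \<in> nearest S (\<xi> + t *\<^sub>R (x - \<xi>))"
      unfolding ray_ends_def by auto
    obtain k where k: "1 / real (Suc k) < t - 1"
      using \<open>t > 1\<close> by (metis diff_gt_0_iff_gt nat_approx_posE)
    \<comment> \<open>Chosen so that \<open>(1 - s) * t = 1 + 1 / real (Suc k)\<close>: contraction
      from the factor \<open>t\<close> ends at that smaller factor.\<close>
    define s where "s = 1 - (1 + 1 / real (Suc k)) / t"
    have s: "0 < s" "s < 1" using k \<open>t > 1\<close> by (auto simp: s_def field_simps)
    have "(\<xi> + t *\<^sub>R (x - \<xi>)) + s *\<^sub>R (\<xi> - (\<xi> + t *\<^sub>R (x - \<xi>))) = \<xi> + (t - s * t) *\<^sub>R (x - \<xi>)"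
      by (simp add: algebra_simps)
    also have "t - s * t = 1 + 1 / real (Suc k)"
      using \<open>t > 1\<close> by (simp add: s_def left_diff_distrib del: of_nat_Suc)
    finally have "\<xi> \<in> nearest S (e k (x, \<xi>))"
      using nearest_inside[OF \<xi>(3), of s] s unfolding e_def fst_conv snd_conv by (metis less_imp_le)
    moreover obtain m where "norm x \<le> real m" using real_arch_simple by blast
    ultimately have "x \<in> A k m"
      unfolding A_def using \<xi>(1) by (intro image_eqI[of _ _ "(x, \<xi>)"]) (auto simp: nearest_def)
    then show "x \<in> (\<Union>k. \<Union>m. A k m)" by blast
  next
    fix x assume "x \<in> (\<Union>k. \<Union>m. A k m)"
    then obtain k \<xi> where "\<xi> \<in> nearest S x" "\<xi> \<in> nearest S (e k (x, \<xi>))"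
      unfolding A_def by (auto simp: nearest_def)
    then show "x \<in> - ray_ends S"
      unfolding ray_ends_def e_def by (auto intro!: bexI[of _ \<xi>] exI[of _ "1 + 1 / real (Suc k)"])
  qed
  ultimately show ?thesis by (metis Compl_in_sets_lebesgue borel_comp double_compl)
qed

text \<open>Up to a null set, a measurable set is a countable union of compact sets, which reduces
  the claim to the compact case.\<close>

lemma negligible_ray_ends:
  fixes S :: "'a::euclidean_space set"
  assumes S: "closed S" "S \<noteq> {}"
  shows "negligible (ray_ends S)"
proof -
  have "ray_ends S \<in> sets lebesgue" using borel_ray_ends[OF S] by (simp add: sets_completionI_sets)
  then obtain C T where C: "fsigma C" "T \<in> null_sets lebesgue" "C \<union> T = ray_ends S"
    using lebesgue_set_almost_fsigma by metis
  obtain F :: "nat \<Rightarrow> 'a set" where F: "range F \<subseteq> Collect compact" "C = \<Union>(F ` UNIV)"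
    using C(1) fsigma_Union_compact by metis
  have "negligible (F n)" for n
  proof -
    have "compact (F n)" "F n \<subseteq> ray_ends S" using F C by auto
    then show ?thesis
      using null_compact_ray_ends[OF S] lmeasurable_compact negligible_iff_measure by blast
  qed
  then have "negligible C" unfolding F(2) by (intro negligible_countable_Union) auto
  then show ?thesis using C by (metis negligible_Un negligible_iff_null_sets)
qed


section \<open>Defining functions of the boundary\<close>

text \<open>\<open>u\<close> is the height above the graph in the rotated coordinates,
  \<open>N\<close> its gradient and \<open>a\<close> the upward vertical direction. As the graph
  function is given on a whole hyperplane, \<open>u\<close> and \<open>N\<close> live on the whole
  space; only the description of \<open>\<Omega>\<close> is confined to \<open>U\<close>.\<close>

lemma C11_boundary_defining_function:
  fixes \<Omega> :: "'a::euclidean_space set"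
  assumes "C11_boundary \<Omega>" "\<xi> \<in> frontier \<Omega>"
  obtains U a N L and u :: "'a \<Rightarrow> real" where
    "open U" "\<xi> \<in> U"
    "\<And>x. (u has_derivative (\<lambda>h. N x \<bullet> h)) (at x)" "L-lipschitz_on UNIV N"
    "\<And>x. N x \<bullet> a = 1" "\<And>x t. u (x + t *\<^sub>R a) = u x + t"
    "\<And>x. x \<in> U \<Longrightarrow> x \<in> \<Omega> \<longleftrightarrow> u x < 0" "\<And>x. x \<in> U \<Longrightarrow> x \<in> frontier \<Omega> \<longleftrightarrow> u x = 0"
proof -
  obtain U and f :: "'a \<Rightarrow> 'a" and c e g where U: "open U" "\<xi> \<in> U" and f: "orthogonal_transformation f"
    and e: "e \<in> Basis" and g: "C11_on_hyperplane e g"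
    and ch: "\<forall>x\<in>U. let y = c + f x in (x \<in> \<Omega> \<longleftrightarrow> y \<bullet> e < g (y - (y \<bullet> e) *\<^sub>R e)) \<and>
           (x \<in> frontier \<Omega> \<longleftrightarrow> y \<bullet> e = g (y - (y \<bullet> e) *\<^sub>R e))"
    using bspec[OF assms(1)[unfolded C11_boundary_def] assms(2)] by (elim exE conjE) (rule that)
  have char: "x \<in> \<Omega> \<longleftrightarrow> (c + f x) \<bullet> e < g ((c + f x) - ((c + f x) \<bullet> e) *\<^sub>R e)"
      "x \<in> frontier \<Omega> \<longleftrightarrow> (c + f x) \<bullet> e = g ((c + f x) - ((c + f x) \<bullet> e) *\<^sub>R e)" if "x \<in> U" for x
    using ch that by (simp_all add: Let_def)
  obtain G L where G: "\<And>y. y \<bullet> e = 0 \<Longrightarrow> G y \<bullet> e = 0"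
    "\<And>y. y \<bullet> e = 0 \<Longrightarrow> (g has_derivative (\<lambda>h. G y \<bullet> h)) (at y within {y. y \<bullet> e = 0})"
    "L-lipschitz_on {y. y \<bullet> e = 0} G"
    using g unfolding C11_on_hyperplane_def by metis
  have ee: "e \<bullet> e = 1" "norm e = 1" using e by auto
  have lf: "linear f" "bounded_linear f"
    using f by (auto simp: orthogonal_transformation_def linear_linear)
  obtain f' where f': "orthogonal_transformation f'" "\<And>x. f (f' x) = x" "\<And>x. f' (f x) = x"
    using orthogonal_transformation_inv[OF f] orthogonal_transformation_bij[OF f]
    by (metis bij_inv_eq_iff)
  have lf': "linear f'" using f' by (auto simp: orthogonal_transformation_def)
  have adj: "f' y \<bullet> x = y \<bullet> f x" for x y
    using f f'(2) unfolding orthogonal_transformation_def by metis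
  \<comment> \<open>\<open>P\<close> gives the horizontal coordinates of a point, and
    \<open>Q\<close> is its derivative.\<close>
  define P where "P x = (c + f x) - ((c + f x) \<bullet> e) *\<^sub>R e" for x
  define Q where "Q h = f h - (f h \<bullet> e) *\<^sub>R e" for h
  have Pe: "P x \<bullet> e = 0" for x by (simp add: P_def inner_simps ee)
  define u where "u x = (c + f x) \<bullet> e - g (P x)" for x
  define N where "N x = f' (e - G (P x))" for x
  define a where "a = f' e"
  have fa: "f a = e" by (simp add: a_def f')
  have derP: "(P has_derivative Q) (at x)" for x
    unfolding P_def Q_def
    by (auto intro!: derivative_eq_intros bounded_linear_imp_has_derivative lf(2))
  show ?thesis
  proof (rule that[where U = U and a = a and u = u and N = N and L = L])
    show "open U" "\<xi> \<in> U" by fact+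
    show "N x \<bullet> a = 1" for x
      unfolding N_def adj fa using G(1)[OF Pe] by (simp add: inner_simps ee)
    show "u (x + t *\<^sub>R a) = u x + t" for x t
    proof -
      have fx: "f (x + t *\<^sub>R a) = f x + t *\<^sub>R e" using lf(1) fa by (simp add: linear_add linear_scale)
      have "P (x + t *\<^sub>R a) = P x" by (simp add: P_def fx inner_simps ee algebra_simps)
      then show ?thesis by (simp add: u_def fx inner_simps ee)
    qed
    show "x \<in> \<Omega> \<longleftrightarrow> u x < 0" "x \<in> frontier \<Omega> \<longleftrightarrow> u x = 0" if "x \<in> U" for x
      using char[OF that] by (auto simp: u_def P_def)
    show "(u has_derivative (\<lambda>h. N x \<bullet> h)) (at x)" for x
    proof -
      have "(g \<circ> P has_derivative (\<lambda>h. G (P x) \<bullet> h) \<circ> Q) (at x within UNIV)"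
        using derP G(2)[OF Pe] Pe by (intro diff_chain_within) (auto intro: has_derivative_subset)
      then have "(u has_derivative (\<lambda>h. f h \<bullet> e - G (P x) \<bullet> Q h)) (at x)"
        unfolding u_def o_def
        by (auto intro!: derivative_eq_intros bounded_linear_imp_has_derivative lf(2))
      \<comment> \<open>The vertical part of \<open>Q h\<close> drops out because \<open>G\<close>
        is horizontal.\<close>
      moreover have "(\<lambda>h. f h \<bullet> e - G (P x) \<bullet> Q h) = (\<lambda>h. N x \<bullet> h)"
        unfolding N_def adj Q_def using G(1)[OF Pe] by (auto simp: inner_simps inner_commute)
      ultimately show ?thesis by simp
    qed
    show "L-lipschitz_on UNIV N"
    proof (rule lipschitz_onI)
      show L0: "0 \<le> L" using G(3) by (rule lipschitz_on_nonneg)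
      fix x y
      have "dist (N x) (N y) = norm (f' (G (P y) - G (P x)))"
        unfolding N_def dist_norm using lf' by (simp add: linear_diff algebra_simps)
      also have "\<dots> = dist (G (P y)) (G (P x))"
        using f' by (simp add: orthogonal_transformation_norm dist_norm)
      also have "\<dots> \<le> L * dist (P y) (P x)"
        using G(3) Pe by (intro lipschitz_onD) auto
      \<comment> \<open>An orthogonal projection after an isometry is 1-Lipschitz, so
        \<open>N\<close> inherits the constant of \<open>G\<close>.\<close>
      also have "dist (P y) (P x) \<le> dist x y"
      proof -
        define h where "h = f (y - x)"
        have "P y - P x = h - (h \<bullet> e) *\<^sub>R e"
          unfolding P_def h_def using lf(1) by (simp add: linear_diff inner_simps algebra_simps)
        moreover have "(norm (h - (h \<bullet> e) *\<^sub>R e))\<^sup>2 = (norm h)\<^sup>2 - (h \<bullet> e)\<^sup>2"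
          unfolding power2_norm_eq_inner
          by (simp add: inner_simps ee inner_commute power2_eq_square algebra_simps)
        then have "norm (h - (h \<bullet> e) *\<^sub>R e) \<le> norm h"
          by (intro power2_le_imp_le[OF _ norm_ge_zero]) simp
        moreover have "norm h = dist x y"
          unfolding h_def using f by (simp add: orthogonal_transformation_norm dist_norm norm_minus_commute)
        ultimately show ?thesis by (simp add: dist_norm)
      qed
      finally show "dist (N x) (N y) \<le> L * dist x y" using L0 by (simp add: mult_left_mono)
    qed
  qed
qed

section \<open>Level curves and normals\<close>

text \<open>
  Since \<open>u (x + t *\<^sub>R a) = u x + t\<close>, the map \<open>x \<mapsto> x - u x *\<^sub>R a\<close> pushes straight lines onto
  curves in the zero set of \<open>u\<close>.
\<close>

lemma level_curve_has_derivative: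
  fixes u :: "'a::euclidean_space \<Rightarrow> real"
  assumes u: "(u has_derivative (\<lambda>h. n \<bullet> h)) (at p)"
  shows "((\<lambda>t. p + t *\<^sub>R v - u (p + t *\<^sub>R v) *\<^sub>R a) has_derivative
           (\<lambda>h. h *\<^sub>R (v - (n \<bullet> v) *\<^sub>R a))) (at 0)"
proof -
  have "((\<lambda>t. u (p + t *\<^sub>R v)) has_derivative (\<lambda>h. n \<bullet> (h *\<^sub>R v))) (at 0)"
    by (rule has_derivative_compose[where f = "\<lambda>t. p + t *\<^sub>R v" and g = u, simplified])
      (auto intro!: derivative_eq_intros u)
  then show ?thesis by (auto intro!: derivative_eq_intros simp: algebra_simps)
qed

lemma level_curve_dist_deriv:
  fixes u :: "'a::euclidean_space \<Rightarrow> real"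
  assumes u: "(u has_derivative (\<lambda>h. n \<bullet> h)) (at p)" and "u p = 0"
  shows "DERIV (\<lambda>t. (dist q (p + t *\<^sub>R v - u (p + t *\<^sub>R v) *\<^sub>R a))\<^sup>2) 0
           :> 2 * ((v - (n \<bullet> v) *\<^sub>R a) \<bullet> (p - q))"
proof -
  define \<gamma> where "\<gamma> t = p + t *\<^sub>R v - u (p + t *\<^sub>R v) *\<^sub>R a" for t :: real
  have \<gamma>0: "\<gamma> 0 = p" using \<open>u p = 0\<close> by (simp add: \<gamma>_def)
  have d\<gamma>: "(\<gamma> has_derivative (\<lambda>h. h *\<^sub>R (v - (n \<bullet> v) *\<^sub>R a))) (at 0)"
    unfolding \<gamma>_def by (rule level_curve_has_derivative[OF u])
  have "((\<lambda>t. (\<gamma> t - q) \<bullet> (\<gamma> t - q)) has_derivative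
      (\<lambda>h. h * (2 * ((v - (n \<bullet> v) *\<^sub>R a) \<bullet> (p - q))))) (at 0)"
    by (auto intro!: derivative_eq_intros d\<gamma> simp: \<gamma>0 inner_commute algebra_simps)
  then have "DERIV (\<lambda>t. (\<gamma> t - q) \<bullet> (\<gamma> t - q)) 0 :> 2 * ((v - (n \<bullet> v) *\<^sub>R a) \<bullet> (p - q))"
    unfolding has_field_derivative_def by (rule has_derivative_eq_rhs) (simp add: fun_eq_iff)
  moreover have "(\<gamma> t - q) \<bullet> (\<gamma> t - q) = (dist q (\<gamma> t))\<^sup>2" for t
    by (simp add: dist_norm norm_minus_commute power2_norm_eq_inner[symmetric])
  ultimately show ?thesis by (simp add: \<gamma>_def)
qed

lemma level_curve_in_nbhd:
  fixes u :: "'a::euclidean_space \<Rightarrow> real"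
  assumes u: "(u has_derivative (\<lambda>h. n \<bullet> h)) (at p)" and "u p = 0" "open U" "p \<in> U"
  obtains d where "d > 0" "\<And>t. \<bar>t\<bar> < d \<Longrightarrow> p + t *\<^sub>R v - u (p + t *\<^sub>R v) *\<^sub>R a \<in> U"
proof -
  define \<gamma> where "\<gamma> t = p + t *\<^sub>R v - u (p + t *\<^sub>R v) *\<^sub>R a" for t :: real
  have \<gamma>0: "\<gamma> 0 = p" using \<open>u p = 0\<close> by (simp add: \<gamma>_def)
  have "isCont \<gamma> 0"
    unfolding \<gamma>_def using level_curve_has_derivative[OF u] has_derivative_continuous by blast
  then have "\<forall>\<^sub>F t in nhds 0. \<gamma> t \<in> U"
    using assms \<gamma>0 by (simp add: isCont_def tendsto_def eventually_nhds_conv_at)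
  then obtain d where "d > 0" "\<And>t. \<bar>t\<bar> < d \<Longrightarrow> \<gamma> t \<in> U"
    by (auto simp: eventually_nhds_metric dist_real_def)
  then show ?thesis using that unfolding \<gamma>_def by blast
qed

text \<open>The squared distance to \<open>q\<close> is stationary at \<open>\<xi>\<close> along the
  level curve of every direction \<open>v\<close>. For \<open>w = \<xi> - q\<close> this says
  \<open>w \<bullet> v = (w \<bullet> a) * (N \<xi> \<bullet> v)\<close>, the Lagrange condition
  with multiplier \<open>w \<bullet> a\<close>.\<close>

lemma normal_at_local_min:
  fixes u :: "'a::euclidean_space \<Rightarrow> real"
  assumes u: "\<And>x. (u has_derivative (\<lambda>h. N x \<bullet> h)) (at x)"
    and sh: "\<And>x t. u (x + t *\<^sub>R a) = u x + t"
    and U: "open U" "\<xi> \<in> U" and "u \<xi> = 0"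
    and min: "\<And>x. x \<in> U \<Longrightarrow> u x = 0 \<Longrightarrow> dist q \<xi> \<le> dist q x"
  shows "\<xi> - q = ((\<xi> - q) \<bullet> a) *\<^sub>R N \<xi>"
proof -
  define w where "w = \<xi> - q"
  have mult: "w \<bullet> v = (w \<bullet> a) * (N \<xi> \<bullet> v)" for v
  proof -
    define \<gamma> where "\<gamma> t = \<xi> + t *\<^sub>R v - u (\<xi> + t *\<^sub>R v) *\<^sub>R a" for t :: real
    have u\<gamma>: "u (\<gamma> t) = 0" for t
      unfolding \<gamma>_def using sh[of _ "- u (\<xi> + t *\<^sub>R v)"] by simp
    have \<gamma>0: "\<gamma> 0 = \<xi>" using \<open>u \<xi> = 0\<close> by (simp add: \<gamma>_def)
    have d\<phi>: "DERIV (\<lambda>t. (dist q (\<gamma> t))\<^sup>2) 0 :> 2 * ((v - (N \<xi> \<bullet> v) *\<^sub>R a) \<bullet> w)"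
      unfolding \<gamma>_def w_def by (rule level_curve_dist_deriv[OF u \<open>u \<xi> = 0\<close>])
    obtain d where d: "d > 0" "\<And>t. \<bar>t\<bar> < d \<Longrightarrow> \<gamma> t \<in> U"
      unfolding \<gamma>_def using level_curve_in_nbhd[OF u \<open>u \<xi> = 0\<close> U] by metis
    have "(dist q (\<gamma> 0))\<^sup>2 \<le> (dist q (\<gamma> t))\<^sup>2" if "\<bar>0 - t\<bar> < d" for t
      unfolding \<gamma>0 using d(2)[of t] that u\<gamma> by (intro power_mono min) auto
    then have "2 * ((v - (N \<xi> \<bullet> v) *\<^sub>R a) \<bullet> w) = 0"
      using DERIV_local_min[OF d\<phi> d(1)] by blast
    then show ?thesis
      by (simp add: inner_diff_left inner_commute[of w v] inner_commute[of w a])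
  qed
  have "(w - (w \<bullet> a) *\<^sub>R N \<xi>) \<bullet> v = 0" for v using mult[of v] by (simp add: inner_diff_left)
  then have "w - (w \<bullet> a) *\<^sub>R N \<xi> = 0" by (metis inner_eq_zero_iff)
  then show ?thesis by (simp add: w_def)
qed

text \<open>Zeros of \<open>u\<close> in \<open>U\<close> lie outside the ball, so
  \<open>\<xi>\<close> minimises the distance to \<open>q\<close> among them. A negative multiplier
  would make \<open>u\<close> increase from \<open>\<xi>\<close> towards \<open>q\<close>, that is,
  into the ball where \<open>u < 0\<close>.\<close>

lemma normal_at_inner_ball:
  fixes u :: "'a::euclidean_space \<Rightarrow> real"
  assumes u: "\<And>x. (u has_derivative (\<lambda>h. N x \<bullet> h)) (at x)"
    and sh: "\<And>x t. u (x + t *\<^sub>R a) = u x + t"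
    and U: "open U" "\<xi> \<in> U" and "u \<xi> = 0"
    and ball: "\<And>x. x \<in> U \<Longrightarrow> dist q x < dist q \<xi> \<Longrightarrow> u x < 0" and "q \<noteq> \<xi>"
  shows "\<xi> - q = ((\<xi> - q) \<bullet> a) *\<^sub>R N \<xi>" "(\<xi> - q) \<bullet> a > 0"
proof -
  define s where "s = (\<xi> - q) \<bullet> a"
  show eq: "\<xi> - q = ((\<xi> - q) \<bullet> a) *\<^sub>R N \<xi>"
    using ball by (intro normal_at_local_min[OF u sh U \<open>u \<xi> = 0\<close>]) force
  define w where "w = \<xi> - q"
  have w: "w = s *\<^sub>R N \<xi>" using eq by (simp add: w_def s_def)
  have "w \<noteq> 0" using \<open>q \<noteq> \<xi>\<close> by (simp add: w_def)
  have "s \<noteq> 0" using w \<open>w \<noteq> 0\<close> by auto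
  moreover have "\<not> s < 0"
  proof
    assume "s < 0"
    define \<phi> where "\<phi> t = u (\<xi> - t *\<^sub>R w)" for t
    have "(\<phi> has_derivative (\<lambda>h. N \<xi> \<bullet> (- (h *\<^sub>R w)))) (at 0)"
      unfolding \<phi>_def
      by (rule has_derivative_compose[where f = "\<lambda>t. \<xi> - t *\<^sub>R w" and g = u, simplified])
        (auto intro!: derivative_eq_intros u)
    then have d: "DERIV \<phi> 0 :> - (N \<xi> \<bullet> w)"
      unfolding has_field_derivative_def by (rule has_derivative_eq_rhs) (simp add: fun_eq_iff)
    have "N \<xi> \<bullet> w < 0"
      using \<open>s < 0\<close> \<open>w \<noteq> 0\<close> by (auto simp: w mult_less_0_iff)
    then obtain e where e: "e > 0" "\<And>t. 0 < t \<Longrightarrow> t < e \<Longrightarrow> \<phi> 0 < \<phi> (0 + t)"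
      using DERIV_pos_inc_right[OF d] by auto
    have "((\<lambda>t. \<xi> - t *\<^sub>R w) \<longlongrightarrow> \<xi> - 0 *\<^sub>R w) (at 0)" by (intro tendsto_intros)
    then have "\<forall>\<^sub>F t in at 0. \<xi> - t *\<^sub>R w \<in> U"
      using U by (auto simp: tendsto_def)
    then obtain d where d: "d > 0" "\<And>t. t \<noteq> 0 \<Longrightarrow> \<bar>t\<bar> < d \<Longrightarrow> \<xi> - t *\<^sub>R w \<in> U"
      by (auto simp: eventually_at dist_real_def)
    \<comment> \<open>The bound \<open>1 / 2\<close> keeps the moved point strictly between
      \<open>\<xi>\<close> and \<open>q\<close>, hence inside the ball.\<close>
    define t where "t = min (min e d / 2) (1 / 2)"
    have t: "0 < t" "t < e" "t < d" "t < 1" using e d by (auto simp: t_def)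
    have "dist q (\<xi> - t *\<^sub>R w) = norm ((1 - t) *\<^sub>R w)"
      by (simp add: w_def dist_norm algebra_simps norm_minus_commute)
    also have "\<dots> < norm w" using t \<open>w \<noteq> 0\<close> by simp
    finally have "u (\<xi> - t *\<^sub>R w) < 0"
      using t d(2)[of t] by (intro ball) (auto simp: w_def dist_norm norm_minus_commute)
    then show False using e(2)[of t] t \<open>u \<xi> = 0\<close> by (simp add: \<phi>_def)
  qed
  ultimately show "(\<xi> - q) \<bullet> a > 0" by (simp add: s_def)
qed


section \<open>Touching balls at a maximum of the distance\<close>

text \<open>
  Along the curve both \<open>p - q\<close> and \<open>p - c = s *\<^sub>R N p\<close> reduce, up to second order, to multiples
  \<open>h\<close> and \<open>s\<close> of the same height \<open>\<kappa> < 0\<close>: the local maximum gives \<open>|\<Delta>|\<^sup>2 + 2 h \<kappa> \<le> 0\<close>, the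
  touching ball gives \<open>|\<Delta>|\<^sup>2 + 2 s \<kappa> \<ge> 0\<close>, whence \<open>s \<le> h\<close> without second derivatives.
\<close>

lemma inner_ball_radius_le_at_local_max:
  fixes u :: "'a::euclidean_space \<Rightarrow> real"
  assumes u: "\<And>x. (u has_derivative (\<lambda>h. N x \<bullet> h)) (at x)"
    and Na: "N p \<bullet> a = 1" and sh: "\<And>x t. u (x + t *\<^sub>R a) = u x + t"
    and U: "open U" "p \<in> U" and "u p = 0"
    and ball: "\<And>x. x \<in> U \<Longrightarrow> dist c x < dist c p \<Longrightarrow> u x < 0" and "c \<noteq> p"
    and max: "d > 0" "\<And>t. \<bar>t\<bar> < d \<Longrightarrow> dist q (p + t *\<^sub>R v - u (p + t *\<^sub>R v) *\<^sub>R a) \<le> dist q p"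
    and v: "\<And>t. v \<noteq> t *\<^sub>R a"
    and h0: "(p - q) \<bullet> a > 0"
  shows "dist c p \<le> (p - q) \<bullet> a * norm (N p)"
proof -
  define h where "h = (p - q) \<bullet> a"
  define s where "s = (p - c) \<bullet> a"
  have s: "p - c = s *\<^sub>R N p" "s > 0"
    unfolding s_def
    using normal_at_inner_ball[OF u sh U \<open>u p = 0\<close> ball \<open>c \<noteq> p\<close>] by auto
  define \<gamma> where "\<gamma> t = p + t *\<^sub>R v - u (p + t *\<^sub>R v) *\<^sub>R a" for t :: real
  have u\<gamma>: "u (\<gamma> t) = 0" for t
    unfolding \<gamma>_def using sh[of _ "- u (p + t *\<^sub>R v)"] by simp
  have \<gamma>0: "\<gamma> 0 = p" using \<open>u p = 0\<close> by (simp add: \<gamma>_def)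
  have d\<phi>: "DERIV (\<lambda>t. (dist q (\<gamma> t))\<^sup>2) 0 :> 2 * ((v - (N p \<bullet> v) *\<^sub>R a) \<bullet> (p - q))"
    unfolding \<gamma>_def by (rule level_curve_dist_deriv[OF u \<open>u p = 0\<close>])
  have "(dist q (\<gamma> t))\<^sup>2 \<le> (dist q (\<gamma> 0))\<^sup>2" if "\<bar>0 - t\<bar> < d" for t
    unfolding \<gamma>0 using max(2)[of t] that by (intro power_mono) (auto simp: \<gamma>_def)
  then have "2 * ((v - (N p \<bullet> v) *\<^sub>R a) \<bullet> (p - q)) = 0"
    using DERIV_local_max[OF d\<phi> max(1)] by blast
  \<comment> \<open>This first-order condition is what makes
    \<open>\<Delta> \<bullet> (p - q)\<close> a multiple of \<open>\<kappa>\<close> below.\<close>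
  then have vq: "v \<bullet> (p - q) = (N p \<bullet> v) * h"
    by (simp add: inner_diff_left[of v] h_def inner_commute[of "p - q" a])
  obtain e where e: "e > 0" "\<And>t. \<bar>t\<bar> < e \<Longrightarrow> \<gamma> t \<in> U"
    unfolding \<gamma>_def using level_curve_in_nbhd[OF u \<open>u p = 0\<close> U] by metis
  \<comment> \<open>A single further point of the curve suffices, within the range \<open>d\<close>
    of the maximum and the range \<open>e\<close> where the curve stays in \<open>U\<close>.\<close>
  define t where "t = Min {d, e} / 2"
  have t: "0 < t" "\<bar>t\<bar> < d" "\<bar>t\<bar> < e" using e max(1) by (auto simp: t_def)
  define \<Delta> where "\<Delta> = \<gamma> t - p"
  define \<kappa> where "\<kappa> = \<Delta> \<bullet> N p"
  \<comment> \<open>A motion transversal to \<open>a\<close> cannot be undone by a push along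
    \<open>a\<close>.\<close>
  have "\<Delta> \<noteq> 0"
  proof
    assume "\<Delta> = 0"
    then have "t *\<^sub>R v = u (p + t *\<^sub>R v) *\<^sub>R a" by (simp add: \<Delta>_def \<gamma>_def)
    then have "v = (u (p + t *\<^sub>R v) / t) *\<^sub>R a"
      using t(1) by (metis divide_inverse_commute left_inverse less_irrefl scaleR_one scaleR_scaleR)
    then show False using v by blast
  qed
  then have \<Delta>pos: "\<Delta> \<bullet> \<Delta> > 0" by simp
  have \<Delta>q: "\<Delta> \<bullet> (p - q) = h * \<kappa>"
  proof -
    have \<Delta>: "\<Delta> = t *\<^sub>R v - u (p + t *\<^sub>R v) *\<^sub>R a" by (simp add: \<Delta>_def \<gamma>_def)
    have "\<kappa> = t * (N p \<bullet> v) - u (p + t *\<^sub>R v)"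
      unfolding \<kappa>_def \<Delta> using Na by (simp add: inner_diff_right inner_commute[of _ "N p"])
    moreover have "\<Delta> \<bullet> (p - q) = t * (v \<bullet> (p - q)) - u (p + t *\<^sub>R v) * h"
      unfolding \<Delta> by (simp add: inner_diff_left[of "t *\<^sub>R v"] h_def inner_commute[of a])
    ultimately show ?thesis by (simp only: vq) (simp add: right_diff_distrib)
  qed
  have \<gamma>dist: "dist z (\<gamma> t) = norm (\<Delta> + (p - z))" "dist z p = norm (p - z)" for z
    by (simp_all add: \<Delta>_def dist_norm norm_minus_commute[of z])
  have "dist q (\<gamma> t) \<le> dist q p" using max(2)[OF t(2)] by (simp only: \<gamma>_def)
  then have "(norm (\<Delta> + (p - q)))\<^sup>2 \<le> (norm (p - q))\<^sup>2"
    unfolding \<gamma>dist by (intro power_mono) auto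
  then have 1: "\<Delta> \<bullet> \<Delta> + 2 * (h * \<kappa>) \<le> 0"
    unfolding \<Delta>q[symmetric]
    by (simp add: power2_norm_eq_inner inner_add_left inner_add_right inner_commute[of "p - q" \<Delta>])
  \<comment> \<open>The curve stays in the zero set of \<open>u\<close> and so avoids the ball,
    where \<open>u < 0\<close>.\<close>
  have "\<not> dist c (\<gamma> t) < dist c p" using ball[OF e(2)[OF t(3)]] u\<gamma>[of t] by auto
  then have "(norm (p - c))\<^sup>2 \<le> (norm (\<Delta> + (p - c)))\<^sup>2"
    unfolding \<gamma>dist by (intro power_mono) auto
  moreover have "\<Delta> \<bullet> (p - c) = s * \<kappa>" by (simp add: s(1) \<kappa>_def)
  ultimately have 2: "0 \<le> \<Delta> \<bullet> \<Delta> + 2 * (s * \<kappa>)"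
    by (simp add: power2_norm_eq_inner inner_add_left inner_add_right inner_commute[of "p - c" \<Delta>]
        mult.commute[of s])
  have "h > 0" using h0 by (simp add: h_def)
  have "h * \<kappa> < 0" using 1 \<Delta>pos by linarith
  then have "\<kappa> < 0" using \<open>h > 0\<close> by (simp add: mult_less_0_iff)
  have "h * \<kappa> \<le> s * \<kappa>" using 1 2 by linarith
  then have "s \<le> h" using \<open>\<kappa> < 0\<close> by (simp add: mult_le_cancel_right)
  have "dist c p = s * norm (N p)" using s by (simp add: dist_norm norm_minus_commute[of c p])
  then show ?thesis using \<open>s \<le> h\<close> by (simp add: h_def mult_right_mono)
qed

text \<open>The ends are also minima, so a maximum attained at an end forces \<open>f\<close> to be
  constant; then the point \<open>1/2\<close> serves.\<close>

lemma interior_max: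
  fixes f :: "real \<Rightarrow> real"
  assumes "continuous_on {0..1} f" "f 0 = f 1" "\<And>t. t \<in> {0..1} \<Longrightarrow> f 0 \<le> f t"
  obtains s where "0 < s" "s < 1" "\<And>t. t \<in> {0..1} \<Longrightarrow> f t \<le> f s"
proof -
  obtain s where s: "s \<in> {0..1}" "\<And>t. t \<in> {0..1} \<Longrightarrow> f t \<le> f s"
    using continuous_attains_sup[OF _ _ assms(1)] by auto
  show ?thesis
  proof (cases "s = 0 \<or> s = 1")
    case True
    then have "f t \<le> f (1/2)" if "t \<in> {0..1}" for t
      using s(2)[OF that] assms(2) assms(3)[of "1/2"] by auto
    then show ?thesis using that[of "1/2"] by simp
  next
    case False
    then have "0 < s" "s < 1" using s(1) by auto
    then show ?thesis using that s(2) by blast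
  qed
qed


section \<open>Inner radius and limits of the ridge\<close>

text \<open>By minimality the ball contains no boundary point; being connected, it lies on one
  side.\<close>

lemma ball_subset_of_nearest:
  fixes \<Omega> :: "'a::euclidean_space set"
  assumes "\<xi> \<in> nearest (frontier \<Omega>) x" "y \<in> ball x (dist \<xi> x)" "y \<in> \<Omega>"
  shows "ball x (dist \<xi> x) \<subseteq> \<Omega>"
proof (rule ccontr)
  assume "\<not> ?thesis"
  then have "ball x (dist \<xi> x) \<inter> frontier \<Omega> \<noteq> {}"
    using assms by (intro connected_Int_frontier) auto
  then obtain z where "z \<in> frontier \<Omega>" "dist z x < dist \<xi> x" by (auto simp: dist_commute)
  then show False using nearestD[OF assms(1)] by fastforce
qed

lemma nearest_frontier_inner_ball:
  fixes \<Omega> :: "'a::euclidean_space set"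
  assumes "open \<Omega>" "x \<in> \<Omega>" "\<xi> \<in> nearest (frontier \<Omega>) x"
  shows "dist \<xi> x > 0" "ball x (dist \<xi> x) \<subseteq> \<Omega>"
proof -
  have "\<xi> \<notin> \<Omega>" using assms by (auto simp: nearest_def frontier_def interior_open)
  then show *: "dist \<xi> x > 0" using assms(2) by auto
  then show "ball x (dist \<xi> x) \<subseteq> \<Omega>"
    using assms by (intro ball_subset_of_nearest[where y = x]) auto
qed

text \<open>The ball about the extended point through \<open>\<xi>\<close> has \<open>t\<close>
  times the radius. It contains \<open>x\<close>, which places it inside \<open>\<Omega>\<close>
  rather than outside.\<close>

lemma inner_radius_ge_of_extension:
  fixes \<Omega> :: "'a::euclidean_space set"
  assumes "open \<Omega>" "x \<in> \<Omega>" "\<xi> \<in> nearest (frontier \<Omega>) x" and t: "t > 1"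
    and ext: "\<xi> \<in> nearest (frontier \<Omega>) (\<xi> + t *\<^sub>R (x - \<xi>))"
  shows "ennreal (t * dist \<xi> x) \<le> inner_radius \<Omega> \<xi>"
proof -
  define x' where "x' = \<xi> + t *\<^sub>R (x - \<xi>)"
  have d0: "dist \<xi> x > 0" using nearest_frontier_inner_ball assms by blast
  have d: "dist \<xi> x' = t * dist \<xi> x"
    using t by (simp add: x'_def dist_norm norm_minus_commute)
  have "x' - x = (t - 1) *\<^sub>R (x - \<xi>)" by (simp add: x'_def algebra_simps)
  then have "dist x' x = (t - 1) * dist \<xi> x"
    using t by (simp add: dist_norm norm_minus_commute)
  then have "x \<in> ball x' (dist \<xi> x')" using d d0 by (simp add: left_diff_distrib)
  then have "ball x' (dist \<xi> x') \<subseteq> \<Omega>"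
    using ball_subset_of_nearest ext assms(2) unfolding x'_def by blast
  then have "locally_inner_touching_ball \<Omega> \<xi> x' (dist \<xi> x')"
    unfolding locally_inner_touching_ball_def using d d0 t
    by (auto simp: dist_commute intro!: exI[of _ UNIV])
  then show ?thesis unfolding inner_radius_def d[symmetric] by (intro SUP_upper) auto
qed

text \<open>The points within distance \<open>1\<close> of \<open>x\<close> that have a nearest
  point outside \<open>U\<close> form a compact set \<open>K\<close>, by compactness of the graph.
  Since \<open>x\<close> is not in \<open>K\<close>, a neighbourhood of \<open>x\<close> avoids
  it.\<close>

lemma nearest_upper_hemicontinuous:
  fixes S :: "'a::euclidean_space set"
  assumes S: "closed S" "S \<noteq> {}" and x: "nearest S x \<subseteq> U" and U: "open U"
  obtains d where "d > 0" "\<And>q. dist q x < d \<Longrightarrow> nearest S q \<subseteq> U"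
proof -
  define K where "K = fst ` ({z. fst z \<in> cball x 1 \<and> snd z \<in> nearest S (fst z)} \<inter> snd -` (- U))"
  have "compact K"
    unfolding K_def using U
    by (intro compact_continuous_image compact_Int_closed compact_nearest_graph S
        continuous_intros compact_cball closed_vimage) auto
  moreover have "x \<notin> K" using x by (auto simp: K_def)
  ultimately obtain d where d: "d > 0" "ball x d \<subseteq> - K"
    using compact_imp_closed open_Compl openE by (metis ComplI)
  have "nearest S q \<subseteq> U" if q: "dist q x < min d 1" for q
  proof
    fix p assume p: "p \<in> nearest S q"
    have "q \<in> ball x d" using q by (simp add: dist_commute)
    then have "q \<notin> K" using d by blast
    then show "p \<in> U"
      using p q unfolding K_def by (force simp: dist_commute intro!: image_eqI[of _ _ "(q, p)"])
  qed
  then show ?thesis using that[of "min d 1"] d(1) by auto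
qed

text \<open>Were \<open>\<xi>\<close> still nearest beyond \<open>x\<close>, then \<open>x\<close>
  would lie strictly inside a minimal segment and have \<open>\<xi>\<close> as its only nearest
  point.\<close>

lemma ridge_subset_ray_ends:
  fixes \<Omega> :: "'a::euclidean_space set"
  assumes "frontier \<Omega> \<noteq> {}"
  shows "ridge \<Omega> \<subseteq> ray_ends (frontier \<Omega>)"
proof
  fix x assume "x \<in> ridge \<Omega>"
  then have ns: "\<not> is_singleton (nearest (frontier \<Omega>) x)"
    by (simp add: ridge_def nearest_def nearest_points_def)
  have "\<not> \<xi> \<in> nearest (frontier \<Omega>) (\<xi> + t *\<^sub>R (x - \<xi>))"
    if \<xi>: "\<xi> \<in> nearest (frontier \<Omega>) x" and t: "t > 1" for \<xi> t
  proof
    assume *: "\<xi> \<in> nearest (frontier \<Omega>) (\<xi> + t *\<^sub>R (x - \<xi>))"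
    \<comment> \<open>As \<open>(1 - s) * t = 1\<close>, contraction by \<open>s\<close> leads from
      the factor \<open>t\<close> back to \<open>x\<close>.\<close>
    define s where "s = 1 - 1 / t"
    have s: "0 < s" "s < 1" using t by (auto simp: s_def)
    have "t - s * t = 1" using t by (simp add: s_def left_diff_distrib)
    moreover have "\<xi> + t *\<^sub>R (x - \<xi>) + s *\<^sub>R (\<xi> - (\<xi> + t *\<^sub>R (x - \<xi>))) = \<xi> + (t - s * t) *\<^sub>R (x - \<xi>)"
      by (simp add: algebra_simps)
    ultimately have x: "\<xi> + t *\<^sub>R (x - \<xi>) + s *\<^sub>R (\<xi> - (\<xi> + t *\<^sub>R (x - \<xi>))) = x" by simp
    have "\<eta> = \<xi>" if "\<eta> \<in> nearest (frontier \<Omega>) x" for \<eta>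
      using nearest_unique_inside[OF * s] that unfolding x by blast
    then have "nearest (frontier \<Omega>) x = {\<xi>}" using \<xi> by blast
    then show False using ns by simp
  qed
  then show "x \<in> ray_ends (frontier \<Omega>)" by (auto simp: ray_ends_def)
qed

text \<open>Otherwise the inner radius at \<open>\<xi>\<close> is at least \<open>t * d\<close>, and
  semicontinuity keeps it above some \<open>R > d\<close> near \<open>\<xi>\<close>. Ridge points
  close to \<open>x\<close> produce boundary points near \<open>\<xi>\<close> at which every
  touching ball has radius below \<open>R\<close>.\<close>

lemma ray_end_of_lsc:
  fixes \<Omega> :: "'a::euclidean_space set"
  assumes \<Omega>: "open \<Omega>" "C11_boundary \<Omega>" and x: "x \<in> cut_locus \<Omega>"
    and single: "nearest (frontier \<Omega>) x = {\<xi>}"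
    and lsc: "inner_radius_lsc \<Omega> \<xi> = inner_radius \<Omega> \<xi>"
  shows "x \<in> ray_ends (frontier \<Omega>)"
proof (rule ccontr)
  define F where "F = frontier \<Omega>"
  assume "x \<notin> ray_ends (frontier \<Omega>)"
  then obtain t where t: "t > 1" and ext: "\<xi> \<in> nearest F (\<xi> + t *\<^sub>R (x - \<xi>))"
    using single by (auto simp: ray_ends_def F_def)
  have \<xi>: "\<xi> \<in> nearest F x" using single by (simp add: F_def)
  have \<xi>F: "\<xi> \<in> F" using \<xi> by (simp add: nearest_def)
  have F: "closed F" "F \<noteq> {}" using \<xi>F by (auto simp: F_def)
  have x\<Omega>: "x \<in> \<Omega>" "x \<in> closure (ridge \<Omega>)" using x by (auto simp: cut_locus_def)
  define d where "d = dist \<xi> x"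
  have d: "d > 0" "ball x d \<subseteq> \<Omega>"
    using nearest_frontier_inner_ball[OF \<Omega>(1) x\<Omega>(1)] \<xi> unfolding d_def F_def by blast+
  \<comment> \<open>The midpoint of \<open>d\<close> and \<open>t * d\<close> leaves room both for
    semicontinuity and for perturbing \<open>x\<close> and \<open>\<xi>\<close>.\<close>
  define R where "R = (1 + t) / 2 * d"
  have R: "d < R" "R < t * d" using d t by (auto simp: R_def field_simps)
  have "ennreal R < ennreal (t * d)" using R d by (intro ennreal_lessI) auto
  also have "\<dots> \<le> inner_radius \<Omega> \<xi>"
    unfolding d_def using inner_radius_ge_of_extension[OF \<Omega>(1) x\<Omega>(1)] \<xi> t ext unfolding F_def by blast
  finally have "ennreal R < inner_radius_lsc \<Omega> \<xi>" using lsc by simp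
  then obtain e1 where e1: "e1 > 0" "ennreal R < (INF \<eta> \<in> ball \<xi> e1 \<inter> F. inner_radius \<Omega> \<eta>)"
    unfolding inner_radius_lsc_eq_SUP less_SUP_iff F_def by auto
  have touch: "\<exists>c r. R < r \<and> locally_inner_touching_ball \<Omega> p c r" if "p \<in> ball \<xi> e1 \<inter> F" for p
  proof -
    have "ennreal R < inner_radius \<Omega> p" using e1(2) INF_lower[OF that] by (rule less_le_trans)
    then obtain r c where "locally_inner_touching_ball \<Omega> p c r" "ennreal R < ennreal r"
      unfolding inner_radius_def less_SUP_iff by auto
    then show ?thesis by (metis ennreal_less_iff ennreal_leI not_le)
  qed
  obtain U a N L and u :: "'a \<Rightarrow> real" where U: "open U" "\<xi> \<in> U"
    and u: "\<And>x. (u has_derivative (\<lambda>h. N x \<bullet> h)) (at x)" and N: "L-lipschitz_on UNIV N"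
    and Na: "\<And>x. N x \<bullet> a = 1" and sh: "\<And>x t. u (x + t *\<^sub>R a) = u x + t"
    and inside: "\<And>x. x \<in> U \<Longrightarrow> x \<in> \<Omega> \<longleftrightarrow> u x < 0"
    and bdry: "\<And>x. x \<in> U \<Longrightarrow> x \<in> F \<longleftrightarrow> u x = 0"
    using C11_boundary_defining_function[OF \<Omega>(2), of \<xi>] \<xi>F unfolding F_def by metis
  have u\<xi>: "u \<xi> = 0" using bdry U \<xi>F by blast
  have contu: "continuous_on A u" for A
    using u by (meson has_derivative_continuous continuous_at_imp_continuous_on)
  have contN: "continuous_on A N" for A
    using lipschitz_on_continuous_on[OF N] continuous_on_subset by blast
  have nx: "\<xi> - x = ((\<xi> - x) \<bullet> a) *\<^sub>R N \<xi>" "(\<xi> - x) \<bullet> a > 0"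
  proof -
    have "u y < 0" if "y \<in> U" "dist x y < dist x \<xi>" for y
      using that inside[OF that(1)] d(2) by (auto simp: d_def dist_commute)
    moreover have "x \<noteq> \<xi>" using d by (auto simp: d_def)
    ultimately show "\<xi> - x = ((\<xi> - x) \<bullet> a) *\<^sub>R N \<xi>" "(\<xi> - x) \<bullet> a > 0"
      using normal_at_inner_ball[OF u sh U u\<xi>] by blast+
  qed
  have "d = (\<xi> - x) \<bullet> a * norm (N \<xi>)"
    unfolding d_def dist_norm by (subst nx(1)) (use nx(2) in simp)
  then have lt: "(\<xi> - x) \<bullet> a * norm (N \<xi>) < R" using R by simp
  \<comment> \<open>Pairs \<open>(q, p)\<close> for which the radius bound at a maximum applies and
    is below \<open>R\<close>. The condition is open and holds at \<open>(x, \<xi>)\<close>, where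
    the bound equals \<open>d\<close>.\<close>
  define V where "V = {z :: 'a \<times> 'a. 0 < (snd z - fst z) \<bullet> a \<and>
      (snd z - fst z) \<bullet> a * norm (N (snd z)) < R}"
  have "open V"
    unfolding V_def
    by (intro open_Collect_conj open_Collect_less continuous_intros
        continuous_on_compose2[OF contN[of UNIV]]) auto
  moreover have "(x, \<xi>) \<in> V" using nx(2) lt by (simp add: V_def)
  ultimately obtain A B where AB: "open A" "open B" "x \<in> A" "\<xi> \<in> B" "A \<times> B \<subseteq> V"
    by (metis open_prod_elim mem_Times_iff fst_conv snd_conv)
  define W where "W = ball \<xi> e1 \<inter> B \<inter> U"
  have W: "open W" "\<xi> \<in> W" using AB U e1 by (auto simp: W_def)
  define g where "g z = z - u z *\<^sub>R a" for z
  have contg: "continuous_on A' g" for A' unfolding g_def by (intro continuous_intros contu)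
  have ug: "u (g z) = 0" for z using sh[of z "- u z"] by (simp add: g_def)
  \<comment> \<open>\<open>g\<close> sends a whole ball about \<open>\<xi>\<close> into
    \<open>W\<close>. The ball is convex, so the segment between two nearest points in it is pushed
    onto a boundary curve in \<open>W\<close>.\<close>
  have "open (g -` W \<inter> U)" using W(1) U(1) contg by (simp add: open_vimage open_Int)
  moreover have "\<xi> \<in> g -` W \<inter> U" using W(2) U(2) u\<xi> by (simp add: g_def)
  ultimately obtain e2 where e2: "e2 > 0" "ball \<xi> e2 \<subseteq> g -` W \<inter> U" by (meson openE)
  obtain e3 where e3: "e3 > 0" "\<And>q. dist q x < e3 \<Longrightarrow> nearest F q \<subseteq> ball \<xi> e2"
    using nearest_upper_hemicontinuous[OF F, of x "ball \<xi> e2"] single e2 unfolding F_def by auto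
  obtain e4 where e4: "e4 > 0" "ball x e4 \<subseteq> A" using AB by (meson openE)
  obtain q where q': "q \<in> ridge \<Omega>" "dist q x < min e3 e4"
    using x\<Omega>(2) e3(1) e4(1) unfolding closure_approachable by (metis min_less_iff_conj)
  then have q: "q \<in> ridge \<Omega>" "q \<in> A" "dist q x < e3" using e4(2) by (auto simp: dist_commute)
  have "\<not> is_singleton (nearest F q)"
    using q(1) by (simp add: ridge_def nearest_def nearest_points_def F_def)
  moreover have "nearest F q \<noteq> {}" by (rule nearest_exists[OF F])
  ultimately obtain p1 p2 where p: "p1 \<in> nearest F q" "p2 \<in> nearest F q" "p1 \<noteq> p2"
    by (metis is_singletonI' )
  define v where "v = p2 - p1"
  define \<gamma> where "\<gamma> s = g (p1 + s *\<^sub>R v)" for s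
  have pb: "p1 \<in> ball \<xi> e2" "p2 \<in> ball \<xi> e2" using e3(2)[OF q(3)] p by auto
  have \<gamma>W: "\<gamma> s \<in> W" if "s \<in> {0..1}" for s
  proof -
    have "p1 + s *\<^sub>R v = (1 - s) *\<^sub>R p1 + s *\<^sub>R p2" by (simp add: v_def algebra_simps)
    then have "p1 + s *\<^sub>R v \<in> ball \<xi> e2" using convexD[OF convex_ball pb] that by simp
    then show ?thesis using e2 by (auto simp: \<gamma>_def)
  qed
  have \<gamma>F: "\<gamma> s \<in> F" if "s \<in> {0..1}" for s
    using \<gamma>W[OF that] bdry ug by (auto simp: W_def \<gamma>_def)
  have "p1 \<in> F" "p2 \<in> F" using p by (auto simp: nearest_def)
  then have up: "u p1 = 0" "u p2 = 0" using pb e2(2) bdry by blast+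
  have ends: "\<gamma> 0 = p1" "\<gamma> 1 = p2" using up by (auto simp: \<gamma>_def g_def v_def)
  \<comment> \<open>Along \<open>a\<close> the value of \<open>u\<close> changes by the length
    parameter, yet \<open>u\<close> vanishes at \<open>p1\<close> and \<open>p2\<close>.\<close>
  have v: "v \<noteq> s *\<^sub>R a" for s
  proof
    assume "v = s *\<^sub>R a"
    then have "u p2 = u p1 + s" using sh[of p1 s] by (simp add: v_def algebra_simps)
    then have "v = 0" using up \<open>v = s *\<^sub>R a\<close> by simp
    then show False using p(3) by (simp add: v_def)
  qed
  define \<phi> where "\<phi> s = dist q (\<gamma> s)" for s
  have c\<phi>: "continuous_on {0..1} \<phi>"
    unfolding \<phi>_def \<gamma>_def
    by (intro continuous_intros continuous_on_compose2[OF contg[of UNIV]]) auto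
  have \<phi>01: "\<phi> 0 = \<phi> 1"
    unfolding \<phi>_def ends using p by (simp add: nearest_def dist_commute)
  have \<phi>ge: "\<phi> 0 \<le> \<phi> s" if "s \<in> {0..1}" for s
    unfolding \<phi>_def ends using nearestD[OF p(1) \<gamma>F[OF that]] by (simp add: dist_commute)
  obtain s where s: "0 < s" "s < 1" "\<And>t. t \<in> {0..1} \<Longrightarrow> \<phi> t \<le> \<phi> s"
    using interior_max[OF c\<phi> \<phi>01 \<phi>ge] by blast
  define P where "P = \<gamma> s"
  have P: "P \<in> W" "P \<in> F" using \<gamma>W \<gamma>F s by (auto simp: P_def)
  obtain c r where r: "R < r" and c: "locally_inner_touching_ball \<Omega> P c r"
    using touch[of P] P by (auto simp: W_def)
  obtain U' where U': "open U'" "P \<in> U'" "ball c r \<inter> U' \<subseteq> \<Omega> \<inter> U'" and r0: "r > 0" "dist c P = r"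
    using c by (auto simp: locally_inner_touching_ball_def)
  \<comment> \<open>Starting the construction anew at \<open>P\<close> gives the same curve with
    shifted parameter, so the maximum at \<open>s\<close> becomes one at \<open>0\<close>.\<close>
  have shift: "P + h *\<^sub>R v - u (P + h *\<^sub>R v) *\<^sub>R a = \<gamma> (s + h)" for h
  proof -
    define z where "z = p1 + s *\<^sub>R v"
    have Pz: "P = z - u z *\<^sub>R a" by (simp add: P_def \<gamma>_def g_def z_def)
    have "P + h *\<^sub>R v = (z + h *\<^sub>R v) + (- u z) *\<^sub>R a" by (simp add: Pz)
    then have *: "u (P + h *\<^sub>R v) = u (z + h *\<^sub>R v) - u z"
      using sh[of "z + h *\<^sub>R v" "- u z"] by (simp only:)
    have "\<gamma> (s + h) = z + h *\<^sub>R v - u (z + h *\<^sub>R v) *\<^sub>R a"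
      by (simp add: \<gamma>_def g_def z_def scaleR_add_left add.assoc)
    then show ?thesis unfolding * by (simp add: Pz scaleR_diff_left)
  qed
  have "dist c P \<le> (P - q) \<bullet> a * norm (N P)"
  proof (rule inner_ball_radius_le_at_local_max[where u = u and U = "U \<inter> U'" and v = v and d = "min s (1 - s)"])
    show "(u has_derivative (\<lambda>h. N x \<bullet> h)) (at x)" for x by (rule u)
    show "N P \<bullet> a = 1" by (rule Na)
    show "u (x + t *\<^sub>R a) = u x + t" for x t by (rule sh)
    show "open (U \<inter> U')" "P \<in> U \<inter> U'" using U U' P by (auto simp: W_def)
    show "u P = 0" by (simp add: P_def \<gamma>_def ug)
    show "u y < 0" if "y \<in> U \<inter> U'" "dist c y < dist c P" for y
      using that U' inside[of y] r0 by auto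
    show "c \<noteq> P" using r0 by auto
    show "0 < min s (1 - s)" using s by simp
    show "dist q (P + h *\<^sub>R v - u (P + h *\<^sub>R v) *\<^sub>R a) \<le> dist q P" if "\<bar>h\<bar> < min s (1 - s)" for h
    proof -
      have "s + h \<in> {0..1}" using that by auto
      then show ?thesis unfolding shift using s(3) by (simp add: \<phi>_def P_def)
    qed
    show "v \<noteq> t *\<^sub>R a" for t by (rule v)
    show "0 < (P - q) \<bullet> a" using AB P q by (auto simp: W_def V_def)
  qed
  moreover have "(P - q) \<bullet> a * norm (N P) < R" using AB P q by (auto simp: W_def V_def)
  ultimately show False using r r0 by simp
qed


section \<open>Normal lines over Hausdorff null sets\<close>

text \<open>All segments over \<open>C \<inter> G\<close> stay within a multiple of \<open>r\<close>
  of the one at a fixed point \<open>p\<close>. At most \<open>2 * T / r + 1\<close> balls of radius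
  \<open>K * r\<close> centred along it cover them, with total volume of order
  \<open>r ^ (DIM('a) - 1)\<close>.\<close>

lemma normal_segments_cover:
  fixes N :: "'a::euclidean_space \<Rightarrow> 'a"
  assumes N: "L-lipschitz_on G N" "\<And>x. x \<in> G \<Longrightarrow> norm (N x) \<le> B" and T: "T \<ge> 0" "B \<ge> 0"
    and r: "0 < r" "r \<le> 1" and C: "\<And>x y. x \<in> C \<Longrightarrow> y \<in> C \<Longrightarrow> dist x y \<le> r"
  obtains W where "W \<in> lmeasurable"
    "{x + s *\<^sub>R N x | x s. x \<in> C \<inter> G \<and> \<bar>s\<bar> \<le> T} \<subseteq> W"
    "measure lebesgue W \<le> (2 * T + 1) * unit_ball_vol (real DIM('a)) * (1 + T * L + B) ^ DIM('a) * r ^ (DIM('a) - 1)"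
proof (cases "C \<inter> G = {}")
  case True
  then show ?thesis
    using r T lipschitz_on_nonneg[OF N(1)] by (intro that[of "{}"]) auto
next
  case False
  then obtain p where p: "p \<in> C" "p \<in> G" by blast
  have L: "L \<ge> 0" using N(1) lipschitz_on_nonneg by blast
  define K where "K = 1 + T * L + B"
  have K: "K > 0" using T L by (simp add: K_def add_pos_nonneg)
  \<comment> \<open>The centres \<open>c 0\<close> to \<open>c m\<close> start at parameter
    \<open>- T\<close> and advance by \<open>r\<close>, which makes \<open>m + 1\<close>
    balls.\<close>
  define m where "m = nat \<lfloor>2 * T / r\<rfloor>"
  define c where "c k = p + (real k * r - T) *\<^sub>R N p" for k :: nat
  define W where "W = (\<Union>k\<le>m. cball (c k) (K * r))"
  show ?thesis
  proof (rule that[of W])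
    show "W \<in> lmeasurable" unfolding W_def by (intro fmeasurable.finite_UN) auto
    show "{x + s *\<^sub>R N x | x s. x \<in> C \<inter> G \<and> \<bar>s\<bar> \<le> T} \<subseteq> W"
    proof clarify
      fix x s assume x: "x \<in> C" "x \<in> G" and s: "\<bar>s\<bar> \<le> T"
      define k where "k = nat \<lfloor>(s + T) / r\<rfloor>"
      have "0 \<le> (s + T) / r" using s r by simp
      then have k: "real k \<le> (s + T) / r" "(s + T) / r \<le> real k + 1"
        unfolding k_def by linarith+
      have kr: "real k * r \<le> s + T" "s + T \<le> real k * r + r"
        using k r by (simp_all add: field_simps)
      have "k \<le> m"
        unfolding k_def m_def using s r by (intro nat_mono floor_mono divide_right_mono) auto
      moreover have "dist (c k) (x + s *\<^sub>R N x) \<le> K * r"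
      proof -
        \<comment> \<open>The errors come from the base point, the rounded parameter and the
          variation of \<open>N\<close>; they add up to at most
          \<open>r + r * B + T * (L * r) = K * r\<close>.\<close>
        have "dist (c k) (x + s *\<^sub>R N x)
           = norm ((p - x) + (real k * r - T - s) *\<^sub>R N p + s *\<^sub>R (N p - N x))"
          by (simp add: dist_norm c_def algebra_simps)
        also have "\<dots> \<le> norm (p - x) + norm ((real k * r - T - s) *\<^sub>R N p) + norm (s *\<^sub>R (N p - N x))"
          by (intro norm_triangle_le add_mono norm_triangle_ineq order_refl)
        also have "norm (p - x) \<le> r" using C[OF p(1) x(1)] by (simp add: dist_norm)
        also have "norm ((real k * r - T - s) *\<^sub>R N p) \<le> r * B"
          using kr N(2)[OF p(2)] r T by (auto intro!: mult_mono)
        also have "norm (s *\<^sub>R (N p - N x)) \<le> T * (L * r)"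
        proof -
          have "norm (N p - N x) \<le> L * dist p x"
            using lipschitz_onD[OF N(1) p(2) x(2)] by (simp add: dist_norm)
          also have "\<dots> \<le> L * r" using C[OF p(1) x(1)] L by (intro mult_left_mono)
          finally show ?thesis using s T L r by (auto intro!: mult_mono)
        qed
        finally show ?thesis by (simp add: K_def algebra_simps)
      qed
      ultimately show "x + s *\<^sub>R N x \<in> W" by (auto simp: W_def)
    qed
    have "measure lebesgue W \<le> (\<Sum>k\<le>m. measure lebesgue (cball (c k) (K * r)))"
      unfolding W_def by (intro measure_UNION_le) auto
    also have "\<dots> = (real m + 1) * (unit_ball_vol (real DIM('a)) * (K * r) ^ DIM('a))"
      using K r by (simp add: content_cball)
    also have "\<dots> \<le> ((2 * T + 1) / r) * (unit_ball_vol (real DIM('a)) * (K * r) ^ DIM('a))"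
    proof (intro mult_right_mono)
      have "real m \<le> 2 * T / r" unfolding m_def using T r by (simp add: of_nat_nat)
      \<comment> \<open>Here \<open>r \<le> 1\<close> absorbs the extra ball into
        \<open>1 / r\<close>.\<close>
      also have "\<dots> + 1 \<le> \<dots> + 1 / r" using r by simp
      finally show "real m + 1 \<le> (2 * T + 1) / r" by (simp add: add_divide_distrib)
    qed (use K r in auto)
    also have "(K * r) ^ DIM('a) = K ^ DIM('a) * (r * r ^ (DIM('a) - 1))"
      unfolding power_mult_distrib power_eq_if[of r "DIM('a)"] by simp
    also have "(2 * T + 1) / r * (unit_ball_vol (real DIM('a)) * (K ^ DIM('a) * (r * r ^ (DIM('a) - 1))))
        = (2 * T + 1) * unit_ball_vol (real DIM('a)) * K ^ DIM('a) * r ^ (DIM('a) - 1)"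
      using r by simp
    finally show "measure lebesgue W \<le> (2 * T + 1) * unit_ball_vol (real DIM('a)) *
        (1 + T * L + B) ^ DIM('a) * r ^ (DIM('a) - 1)"
      by (simp add: K_def)
  qed
qed

text \<open>If sets of diameters \<open>D i\<close> cover \<open>G\<close>, the segments have a
  cover of measure at most \<open>K\<close> times the sum of \<open>D i ^ m\<close>, up to an
  arbitrarily small surplus; that sum can be made small.\<close>

lemma negligible_normal_segments_bounded:
  fixes N :: "'a::euclidean_space \<Rightarrow> 'a"
  assumes dim: "DIM('a) \<ge> 2" and G: "hausdorff_measure (DIM('a) - 1) G = 0"
    and N: "L-lipschitz_on G N" "\<And>x. x \<in> G \<Longrightarrow> norm (N x) \<le> B" and T: "T \<ge> 0" "B \<ge> 0"
  shows "negligible {x + s *\<^sub>R N x | x s. x \<in> G \<and> \<bar>s\<bar> \<le> T}" (is "negligible ?Z")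
proof -
  define m where "m = DIM('a) - 1"
  have m: "m \<ge> 1" using dim by (simp add: m_def)
  define \<omega> where "\<omega> = unit_ball_vol (real m)"
  have \<omega>: "\<omega> > 0" by (simp add: \<omega>_def)
  define K where "K = (2 * T + 1) * unit_ball_vol (real DIM('a)) * (1 + T * L + B) ^ DIM('a)"
  have L: "L \<ge> 0" using N(1) lipschitz_on_nonneg by blast
  have K: "K \<ge> 0" using T L by (simp add: K_def)
  have small: "\<exists>W. W \<in> sets lebesgue \<and> ?Z \<subseteq> W \<and> emeasure lebesgue W \<le> ennreal e" if e: "e > 0" for e
  proof -
    \<comment> \<open>Ensures \<open>K * (e1 + e1) \<le> e\<close>: one \<open>e1\<close> pays for
      the diameters, the other for enlarging them.\<close>
    define e1 where "e1 = e / (K + 1) / 2"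
    have e1: "e1 > 0" using e K by (simp add: e1_def)
    \<comment> \<open>Undoes the normalisation of Hausdorff measure:
      \<open>2 ^ m / \<omega> * e2 = e1\<close>.\<close>
    define e2 where "e2 = e1 * \<omega> / 2 ^ m"
    have e2: "e2 > 0" using e1 \<omega> by (simp add: e2_def)
    \<comment> \<open>The scale \<open>1/2\<close> leaves room below \<open>1\<close> for enlarging
      the diameters.\<close>
    have "hausdorff_pre m (1/2) G \<le> hausdorff_measure m G"
      unfolding hausdorff_measure_def by (intro SUP_upper) auto
    then have "hausdorff_pre m (1/2) G < ennreal e2" using G e2 by (simp add: m_def)
    then obtain C where C: "G \<subseteq> (\<Union>i. C i)" "\<And>i. bounded (C i)" "\<And>i. diameter (C i) \<le> 1/2"
      and sumC: "(\<Sum>i. hausdorff_size m (C i)) < ennreal e2"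
      unfolding hausdorff_pre_def INF_less_iff by auto
    define D where "D i = diameter (C i)" for i :: nat
    have D: "0 \<le> D i" "D i \<le> 1/2" for i using C by (auto simp: D_def diameter_ge_0)
    have size: "ennreal (D i ^ m) \<le> ennreal (2 ^ m / \<omega>) * hausdorff_size m (C i)" for i
    proof (cases "C i = {}")
      \<comment> \<open>The empty set has diameter \<open>0\<close>, and \<open>m \<ge> 1\<close>
        makes the power vanish.\<close>
      case True then show ?thesis using m by (simp add: D_def power_0_left)
    next
      case False
      then have "ennreal (2 ^ m / \<omega>) * hausdorff_size m (C i)
          = ennreal (2 ^ m / \<omega> * (\<omega> * (D i / 2) ^ m))"
        using D[of i] \<omega>
        by (subst ennreal_mult) (simp_all add: hausdorff_size_def \<omega>_def D_def)
      also have "2 ^ m / \<omega> * (\<omega> * (D i / 2) ^ m) = D i ^ m" using \<omega> by (simp add: power_divide)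
      finally show ?thesis by simp
    qed
    \<comment> \<open>Covering radii must be positive while \<open>D i\<close> may be
      \<open>0\<close>; the allowances \<open>e1 * (1/2) ^ Suc i\<close> sum to
      \<open>e1\<close>.\<close>
    have "\<exists>r. D i < r \<and> r \<le> 1 \<and> r ^ m \<le> D i ^ m + e1 * (1/2) ^ Suc i" for i
    proof -
      have "((\<lambda>r. r ^ m) \<longlongrightarrow> D i ^ m) (at_right (D i))" by (intro tendsto_intros)
      moreover have "D i ^ m < D i ^ m + e1 * (1/2) ^ Suc i" using e1 by simp
      ultimately have "\<forall>\<^sub>F r in at_right (D i). r ^ m < D i ^ m + e1 * (1/2) ^ Suc i"
        by (rule order_tendstoD)
      moreover have "\<forall>\<^sub>F r in at_right (D i). D i < r \<and> r < 1"
        using eventually_at_right_real[of "D i" 1] D(2)[of i] by simp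
      ultimately have "\<forall>\<^sub>F r in at_right (D i). D i < r \<and> r \<le> 1 \<and> r ^ m \<le> D i ^ m + e1 * (1/2) ^ Suc i"
        by eventually_elim auto
      then show ?thesis using eventually_happens trivial_limit_at_right_real by blast
    qed
    then obtain r where r: "\<And>i. D i < r i" "\<And>i. r i \<le> 1"
      "\<And>i. r i ^ m \<le> D i ^ m + e1 * (1/2) ^ Suc i" by metis
    define Z where "Z i = {x + s *\<^sub>R N x | x s. x \<in> C i \<inter> G \<and> \<bar>s\<bar> \<le> T}" for i
    have "\<exists>W. W \<in> lmeasurable \<and> Z i \<subseteq> W \<and>
        measure lebesgue W \<le> K * r i ^ m" for i
    proof -
      have ri: "0 < r i" using D(1) r(1) by (rule le_less_trans)
      have "dist x y \<le> r i" if "x \<in> C i" "y \<in> C i" for x y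
        using diameter_bounded_bound[OF C(2) that] r(1)[of i] by (simp add: D_def)
      from normal_segments_cover[OF N T ri r(2) this, where C = "C i"]
      obtain W where "W \<in> lmeasurable"
        "Z i \<subseteq> W"
        "measure lebesgue W \<le> K * r i ^ m"
        unfolding K_def m_def Z_def by blast
      then show ?thesis by blast
    qed
    then obtain W where W: "\<And>i. W i \<in> lmeasurable"
      "\<And>i. Z i \<subseteq> W i"
      "\<And>i. measure lebesgue (W i) \<le> K * r i ^ m" by metis
    have "?Z \<subseteq> (\<Union>i. W i)" using C(1) W(2) unfolding Z_def by fastforce
    moreover have "(\<Union>i. W i) \<in> sets lebesgue" using W(1) by (intro sets.countable_UN) auto
    moreover have "emeasure lebesgue (\<Union>i. W i) \<le> ennreal e"
    proof -
      have "emeasure lebesgue (\<Union>i. W i) \<le> (\<Sum>i. emeasure lebesgue (W i))"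
        using W(1) by (intro emeasure_subadditive_countably) auto
      also have "\<dots> \<le> (\<Sum>i. ennreal K * (ennreal (2 ^ m / \<omega>) * hausdorff_size m (C i) + ennreal (e1 * (1/2) ^ Suc i)))"
      proof (rule suminf_le)
        fix i
        have "emeasure lebesgue (W i) = ennreal (measure lebesgue (W i))"
          using W(1) by (simp add: emeasure_eq_measure2)
        also have "\<dots> \<le> ennreal (K * (D i ^ m + e1 * (1/2) ^ Suc i))"
          using W(3)[of i] r(3)[of i] K by (intro ennreal_leI) (meson mult_left_mono order_trans)
        also have "\<dots> = ennreal K * (ennreal (D i ^ m) + ennreal (e1 * (1/2) ^ Suc i))"
          using K D(1)[of i] e1 by (simp add: ennreal_mult ennreal_plus)
        also have "\<dots> \<le> ennreal K * (ennreal (2 ^ m / \<omega>) * hausdorff_size m (C i) + ennreal (e1 * (1/2) ^ Suc i))"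
          by (intro mult_left_mono add_right_mono size) simp
        finally show "emeasure lebesgue (W i) \<le> \<dots>" .
      qed auto
      also have "\<dots> = ennreal K * (ennreal (2 ^ m / \<omega>) * (\<Sum>i. hausdorff_size m (C i)) + (\<Sum>i. ennreal (e1 * (1/2) ^ Suc i)))"
        by (simp add: suminf_add[symmetric] del: power_Suc)
      also have "(\<Sum>i. ennreal (e1 * (1/2) ^ Suc i)) = ennreal e1"
        using sums_mult[OF power_half_series, of e1] e1
        by (intro suminf_ennreal_eq) auto
      also have "ennreal (2 ^ m / \<omega>) * (\<Sum>i. hausdorff_size m (C i)) \<le> ennreal (2 ^ m / \<omega>) * ennreal e2"
        using sumC by (intro mult_left_mono) auto
      also have "\<dots> = ennreal e1"
        using e2 \<omega> by (simp add: ennreal_mult[symmetric] e2_def)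
      also have "ennreal K * (ennreal e1 + ennreal e1) = ennreal (K * (e1 + e1))"
        using K e1 by (simp only: ennreal_mult ennreal_plus add_nonneg_nonneg less_imp_le)
      also have "\<dots> \<le> ennreal e"
      proof (intro ennreal_leI)
        have "e1 + e1 = e / (K + 1)" unfolding e1_def by (rule field_sum_of_halves)
        then have "K * (e1 + e1) = K / (K + 1) * e" by (simp only:) simp
        also have "\<dots> \<le> 1 * e" using K e by (intro mult_right_mono) auto
        finally show "K * (e1 + e1) \<le> e" by simp
      qed
      finally show ?thesis by (simp add: add_mono mult_left_mono)
    qed
    ultimately show ?thesis by blast
  qed
  show ?thesis
    unfolding negligible_outer_le
  proof (intro allI impI)
    fix e :: real assume e: "e > 0"
    obtain W where W: "W \<in> sets lebesgue" "?Z \<subseteq> W" "emeasure lebesgue W \<le> ennreal e"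
      using small[OF e] by blast
    then have "W \<in> lmeasurable" by (intro fmeasurableI) (auto simp: le_less_trans)
    moreover have "measure lebesgue W \<le> e"
      using W(3) e by (simp add: measure_def enn2real_leI)
    ultimately show "\<exists>T. ?Z \<subseteq> T \<and> T \<in> lmeasurable \<and> measure lebesgue T \<le> e" using W by blast
  qed
qed

text \<open>Since \<open>N\<close> may be unbounded and the lines are infinite, both
  \<open>norm (N x)\<close> and the parameter are cut off at \<open>k\<close>, and the union over
  \<open>k\<close> is taken.\<close>

lemma negligible_normal_lines:
  fixes N :: "'a::euclidean_space \<Rightarrow> 'a"
  assumes dim: "DIM('a) \<ge> 2" and G: "hausdorff_measure (DIM('a) - 1) G = 0"
    and N: "L-lipschitz_on UNIV N"
  shows "negligible {x + s *\<^sub>R N x | x s. x \<in> G}"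
proof -
  define Z where "Z k = {x + s *\<^sub>R N x | x s. x \<in> {x \<in> G. norm (N x) \<le> real k} \<and> \<bar>s\<bar> \<le> real k}" for k
  have "negligible (Z k)" for k
    unfolding Z_def
  proof (rule negligible_normal_segments_bounded[OF dim])
    have "hausdorff_measure (DIM('a) - 1) {x \<in> G. norm (N x) \<le> real k} \<le> hausdorff_measure (DIM('a) - 1) G"
      unfolding hausdorff_measure_def hausdorff_pre_def
      by (intro SUP_mono bexI INF_superset_mono order_refl) auto
    then show "hausdorff_measure (DIM('a) - 1) {x \<in> G. norm (N x) \<le> real k} = 0" using G by simp
    show "L-lipschitz_on {x \<in> G. norm (N x) \<le> real k} N" using N lipschitz_on_subset by blast
  qed auto
  then have "negligible (\<Union>k. Z k)" by (rule negligible_Union_nat)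
  moreover have "{x + s *\<^sub>R N x | x s. x \<in> G} \<subseteq> (\<Union>k. Z k)"
  proof clarify
    fix x s assume "x \<in> G"
    obtain k where k: "max (norm (N x)) \<bar>s\<bar> \<le> real k" using real_arch_simple by blast
    then have "x + s *\<^sub>R N x \<in> Z k" using \<open>x \<in> G\<close> by (auto simp: Z_def)
    then show "x + s *\<^sub>R N x \<in> (\<Union>k. Z k)" by blast
  qed
  ultimately show ?thesis by (rule negligible_subset)
qed

section \<open>Covering the cut locus by ray ends and exceptional normal lines\<close>

theorem theorem4p1:
  fixes \<Omega> :: "(real ^ 'n) set"
  assumes "CARD('n) \<ge> 2"
    and "open \<Omega>"
    and "frontier \<Omega> \<noteq> {}"
    and "C11_boundary \<Omega>"
    and "\<exists>\<Gamma> \<subseteq> frontier \<Omega>. hausdorff_measure (CARD('n) - 1) \<Gamma> = 0 \<and>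
           (\<forall>\<xi> \<in> frontier \<Omega> - \<Gamma>. inner_radius_lsc \<Omega> \<xi> = inner_radius \<Omega> \<xi>)"
  shows "cut_locus \<Omega> \<in> null_sets lebesgue"
proof -
  define F where "F = frontier \<Omega>"
  have F: "closed F" "F \<noteq> {}" using assms(3) by (auto simp: F_def)
  obtain \<Gamma> where \<Gamma>: "\<Gamma> \<subseteq> F" "hausdorff_measure (CARD('n) - 1) \<Gamma> = 0"
    and lsc: "\<And>\<xi>. \<xi> \<in> F - \<Gamma> \<Longrightarrow> inner_radius_lsc \<Omega> \<xi> = inner_radius \<Omega> \<xi>"
    using assms(5) unfolding F_def by blast
  \<comment> \<open>Stationarity of the distance at a nearest point \<open>p\<close> puts
    \<open>x\<close> on the normal line at \<open>p\<close>; one Lipschitz field supplies the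
    normals near \<open>\<xi>\<close>.\<close>
  have chart: "\<exists>U N L. open U \<and> \<xi> \<in> U \<and> L-lipschitz_on UNIV N \<and>
      (\<forall>x p. p \<in> U \<and> p \<in> nearest F x \<longrightarrow> (\<exists>s. x = p + s *\<^sub>R N p))" if \<xi>: "\<xi> \<in> F" for \<xi>
  proof -
    obtain U a N L and u :: "real ^ 'n \<Rightarrow> real" where U: "open U" "\<xi> \<in> U"
      and u: "\<And>x. (u has_derivative (\<lambda>h. N x \<bullet> h)) (at x)" and N: "L-lipschitz_on UNIV N"
      and "\<And>x. N x \<bullet> a = 1" and sh: "\<And>x t. u (x + t *\<^sub>R a) = u x + t" and bdry: "\<And>x. x \<in> U \<Longrightarrow> x \<in> F \<longleftrightarrow> u x = 0"
      using C11_boundary_defining_function[OF assms(4) \<xi>[unfolded F_def]] unfolding F_def by metis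
    have "\<exists>s. x = p + s *\<^sub>R N p" if p: "p \<in> U" "p \<in> nearest F x" for x p
    proof -
      have "u p = 0" using p bdry by (auto simp: nearest_def)
      then have "p - x = ((p - x) \<bullet> a) *\<^sub>R N p"
        using p bdry nearestD[OF p(2)]
        by (intro normal_at_local_min[OF u sh U(1) p(1)]) (auto simp: dist_commute)
      then obtain c where "p - x = c *\<^sub>R N p" by blast
      then have "x = p + (- c) *\<^sub>R N p" by (simp add: algebra_simps)
      then show ?thesis by blast
    qed
    then show ?thesis using U N by blast
  qed
  then obtain U N L where U: "\<And>\<xi>. \<xi> \<in> F \<Longrightarrow> open (U \<xi>) \<and> \<xi> \<in> U \<xi>"
    and N: "\<And>\<xi>. \<xi> \<in> F \<Longrightarrow> (L \<xi>)-lipschitz_on UNIV (N \<xi>)"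
    and seg: "\<And>\<xi> x p. \<xi> \<in> F \<Longrightarrow> p \<in> U \<xi> \<Longrightarrow> p \<in> nearest F x \<Longrightarrow> \<exists>s. x = p + s *\<^sub>R N \<xi> p"
    by metis
  \<comment> \<open>Passing to countably many charts keeps the union of the exceptional sets
    null.\<close>
  obtain J where J: "J \<subseteq> U ` F" "countable J" "\<Union>J = \<Union>(U ` F)"
    using Lindelof[of "U ` F"] U by blast
  obtain I where I: "I \<subseteq> F" "countable I" "J = U ` I"
    using J(1,2) by (metis countable_subset_image)
  \<comment> \<open>\<open>N \<xi>\<close> is Lipschitz on the whole space, so all of
    \<open>\<Gamma>\<close> can enter for each chart. Off \<open>U \<xi>\<close> the lines need not
    be normal, but they still sweep out a null set.\<close>
  define Z where "Z \<xi> = {x + s *\<^sub>R N \<xi> x | x s. x \<in> \<Gamma>}" for \<xi>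
  have "negligible (Z \<xi>)" if "\<xi> \<in> I" for \<xi>
    unfolding Z_def using assms(1) \<Gamma>(2) N that I(1) by (intro negligible_normal_lines) auto
  then have "negligible (\<Union>\<xi>\<in>I. Z \<xi>)"
    using I(2) by (intro negligible_countable_Union) auto
  moreover have "negligible (ray_ends F)" by (rule negligible_ray_ends[OF F])
  moreover have "cut_locus \<Omega> \<subseteq> ray_ends F \<union> (\<Union>\<xi>\<in>I. Z \<xi>)"
  proof
    fix x assume x: "x \<in> cut_locus \<Omega>"
    show "x \<in> ray_ends F \<union> (\<Union>\<xi>\<in>I. Z \<xi>)"
    proof (cases "x \<in> ridge \<Omega>")
      case True
      then show ?thesis using ridge_subset_ray_ends[OF assms(3)] by (auto simp: F_def)
    next
      case False
      then obtain p where p: "nearest F x = {p}"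
        using x by (auto simp: ridge_def cut_locus_def nearest_def nearest_points_def F_def is_singleton_def)
      then have pF: "p \<in> F" by (auto simp: nearest_def)
      show ?thesis
      proof (cases "p \<in> \<Gamma>")
        case True
        obtain \<xi> where \<xi>: "\<xi> \<in> I" "p \<in> U \<xi>" using pF U J(3) I(3) by blast
        then obtain s where "x = p + s *\<^sub>R N \<xi> p" using seg[of \<xi> p x] p I(1) by blast
        then have "x \<in> Z \<xi>" using True by (auto simp: Z_def)
        then show ?thesis using \<xi>(1) by blast
      next
        case False
        then have "x \<in> ray_ends (frontier \<Omega>)"
          using ray_end_of_lsc[OF assms(2,4) x] p pF lsc unfolding F_def by blast
        then show ?thesis by (simp add: F_def)
      qed
    qed
  qed
  ultimately have "negligible (cut_locus \<Omega>)" by (meson negligible_Un negligible_subset)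
  then show ?thesis by (simp add: negligible_iff_null_sets)
qed

end
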